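(* Let $k\ge 0$ be an integer. Every graph $G$ with treewidth $k$ has a tree-decomposition with width at most $14k+13$ and degree at most $6$, such that each vertex $v\in V(G)$ has spread at most $\deg_G(v)+1$.
   Context: Graphs are simple, undirected and finite. For a non-empty tree $T$, a $T$-decomposition of a graph $G$ is a collection $(B_x:x\in V(T))$ of subsets $B_x\subseteq V(G)$ (bags) such that for each edge $vw\in E(G)$ some bag contains both $v$ and $w$, and for each $v\in V(G)$ the set $\{x\in V(T):v\in B_x\}$ induces a non-empty connected subtree of $T$. A tree-decomposition is a $T$-decomposition for some tree $T$. Its width is $\max_x|B_x|-1$, its degree is the maximum degree of $T$, and the spread of a vertex $v$ is the number of nodes $x$ with $v\in B_x$. The treewidth of $G$ is the minimum width of a tree-decomposition of $G$. *)

theory Defs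
  imports "Graph_Theory.Digraph_Component"
begin

text \<open>
  A finite simple undirected graph is a \<open>pair_graph\<close>: an edge \<open>uv\<close> is represented by the two arcs
  \<open>(u, v)\<close> and \<open>(v, u)\<close>, so that the degree of \<open>v\<close> is its \<open>out_degree\<close>.

  The library predicate \<open>tree\<close> does not apply here: in a symmetric digraph, every edge gives a
  directed cycle \<open>u, v, u\<close> of length 2. The cycles of the undirected graph are the
  directed ones of length at least 3. The library predicate \<open>connected\<close> includes non-emptiness.
\<close>

definition undirected_tree :: "'n pair_pre_digraph \<Rightarrow> bool" where
  "undirected_tree T \<longleftrightarrow> pair_graph T \<and> connected (with_proj T) \<and>
     \<not> (\<exists>p. pre_digraph.cycle (with_proj T) p \<and> 3 \<le> length p)"

definition max_degree :: "'n pair_pre_digraph \<Rightarrow> nat" where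
  "max_degree T = Max (out_degree (with_proj T) ` pverts T)"

definition bag_nodes :: "'n pair_pre_digraph \<Rightarrow> ('n \<Rightarrow> 'a set) \<Rightarrow> 'a \<Rightarrow> 'n set" where
  "bag_nodes T B v = {x \<in> pverts T. v \<in> B x}"

definition tree_decomposition ::
    "'n pair_pre_digraph \<Rightarrow> ('n \<Rightarrow> 'a set) \<Rightarrow> 'a pair_pre_digraph \<Rightarrow> bool" where
  "tree_decomposition T B G \<longleftrightarrow>
     undirected_tree T \<and>
     (\<forall>x \<in> pverts T. B x \<subseteq> pverts G) \<and>
     (\<forall>(v, w) \<in> parcs G. \<exists>x \<in> pverts T. v \<in> B x \<and> w \<in> B x) \<and>
     (\<forall>v \<in> pverts G. bag_nodes T B v \<noteq> {} \<and> connected (with_proj T \<restriction> bag_nodes T B v))"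

text \<open>
  Widths are integers: the graph without vertices has a tree-decomposition of width \<open>-1\<close>.
\<close>

definition decomposition_width :: "'n pair_pre_digraph \<Rightarrow> ('n \<Rightarrow> 'a set) \<Rightarrow> int" where
  "decomposition_width T B = int (Max ((\<lambda>x. card (B x)) ` pverts T)) - 1"

definition spread :: "'n pair_pre_digraph \<Rightarrow> ('n \<Rightarrow> 'a set) \<Rightarrow> 'a \<Rightarrow> nat" where
  "spread T B v = card (bag_nodes T B v)"

text \<open>
  Trees are finite, so it is no restriction to take natural numbers as their nodes.
  The minimum exists, since widths are at least \<open>-1\<close> and some tree-decomposition always exists
  (a single node whose bag contains all vertices).
\<close>

definition treewidth :: "'a pair_pre_digraph \<Rightarrow> int" where
  "treewidth G = (LEAST w. \<exists>(T :: nat pair_pre_digraph) B.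
     tree_decomposition T B G \<and> decomposition_width T B = w)"

end

theory Submission
  imports Defs
begin

text \<open>
  A recursion along balanced separators. Write \<open>K = k + 1\<close>. To decompose the graph on
  \<open>R \<union> U\<close> with a prescribed set \<open>R\<close>, \<open>|R| \<le> 6K\<close>, inside the root bag, add to \<open>R\<close> one
  neighbour in \<open>U\<close> of each vertex of \<open>R\<close>. Two bags of an optimal tree-decomposition
  separate the resulting set \<open>Y\<close>, \<open>|Y| \<le> 12K\<close>, into pieces with at most \<open>4K\<close> vertices
  of \<open>Y\<close> each, and greedy merging leaves at most 5 pieces. The root bag is \<open>Y\<close> together with the
  separator, of size at most \<open>14K\<close>, and a piece inherits from the root bag only the vertices
  with a neighbour in it, at most \<open>4K + 2K\<close> many. A vertex is passed on to no more pieces than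
  it has neighbours there, and for a vertex of \<open>R\<close> the neighbour added to the root bag
  pays for the root, so that its spread in \<open>R \<union> U\<close> is at most the number of its neighbours in \<open>U\<close>
  (if it has any). Summing over the pieces gives the bound on the spread.
\<close>

subsection \<open>Rooted decompositions and undirected trees\<close>

definition connected_on :: "'n rel \<Rightarrow> 'n set \<Rightarrow> bool" where
  "connected_on E S \<longleftrightarrow> S \<noteq> {} \<and> (\<forall>u\<in>S. \<forall>v\<in>S. (u, v) \<in> (E \<inter> S \<times> S)\<^sup>*)"

definition acyclic_on :: "'n rel \<Rightarrow> 'n set \<Rightarrow> bool" where
  "acyclic_on E V \<longleftrightarrow> \<not> (\<exists>xs. set xs \<subseteq> V \<and> distinct xs \<and> 3 \<le> length xs \<and>
     successively (\<lambda>u v. (u, v) \<in> E) xs \<and> (last xs, hd xs) \<in> E)"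

text \<open>
  The tree has nodes \<open>{..<n}\<close>, root 0 and parent function \<open>p\<close>. Since parents have smaller
  numbers than their children, connectedness of the nodes containing a vertex is the running
  intersection property.
\<close>

definition rooted_decomposition :: "nat \<Rightarrow> (nat \<Rightarrow> nat) \<Rightarrow> (nat \<Rightarrow> 'a set) \<Rightarrow> bool" where
  "rooted_decomposition n p B \<longleftrightarrow> 0 < n \<and> (\<forall>i. 0 < i \<and> i < n \<longrightarrow> p i < i) \<and>
     (\<forall>i j. j < i \<and> i < n \<longrightarrow> B i \<inter> B j \<subseteq> B (p i))"

section \<open>Translation between arc walks and relations on vertices\<close>

lemma connected_induce_iff:
  assumes "sym (parcs T)"
  shows "connected (with_proj T \<restriction> S) \<longleftrightarrow> connected_on (parcs T) S"
proof -
  have ends: "arcs_ends (with_proj T \<restriction> S) = parcs T \<inter> S \<times> S"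
    by (auto simp: arcs_ends_conv)
  have "symcl (parcs T \<inter> S \<times> S) = parcs T \<inter> S \<times> S"
    using assms by (auto simp: symcl_def dest: symD)
  moreover have "(u, v) \<in> rtrancl_on S (parcs T \<inter> S \<times> S) \<longleftrightarrow> (u, v) \<in> (parcs T \<inter> S \<times> S)\<^sup>*"
    if "u \<in> S" "v \<in> S" for u v
    using that by (blast intro: rtrancl_on_rtranclI rtrancl_consistent_rtrancl_on)
  ultimately show ?thesis
    by (auto simp: connected_conv ends connected_on_def)
qed

lemma induce_subgraph_pverts:
  assumes "pair_wf_digraph T"
  shows "with_proj T \<restriction> pverts T = with_proj T"
  using assms
  by (auto simp: induce_subgraph_def with_proj_def pair_wf_digraph_def)

text \<open>Listing only the heads of the arcs, a closed walk names its start once, at the end. This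
  is the form of cycle that \<open>acyclic_on\<close> speaks of.\<close>

lemma pcas_map_snd:
  assumes "pcas u p v" "p \<noteq> []"
  shows "successively (\<lambda>x y. (x, y) \<in> set p) (map snd p)" "(u, hd (map snd p)) \<in> set p"
    "last (map snd p) = v"
proof -
  have "successively (\<lambda>x y. (x, y) \<in> set p) (map snd p) \<and> (u, hd (map snd p)) \<in> set p \<and>
      last (map snd p) = v"
    using assms
  proof (induction p arbitrary: u)
    case (Cons e es)
    show ?case
    proof (cases es)
      case Nil
      then show ?thesis using Cons.prems by (cases e) auto
    next
      case (Cons e' es')
      with Cons.prems have "pcas (snd e) es v" "es \<noteq> []" "fst e = u" by auto
      with Cons.IH[of "snd e"] have *: "successively (\<lambda>x y. (x, y) \<in> set es) (map snd es)"
        "(snd e, hd (map snd es)) \<in> set es" "last (map snd es) = v" by auto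
      have "successively (\<lambda>x y. (x, y) \<in> set (e # es)) (map snd es)"
        by (rule successively_mono[OF *(1)]) auto
      moreover have "e = (u, snd e)" using \<open>fst e = u\<close> by (cases e) auto
      ultimately show ?thesis using * Cons
        by (auto simp: successively_Cons)
    qed
  qed simp
  then show "successively (\<lambda>x y. (x, y) \<in> set p) (map snd p)" "(u, hd (map snd p)) \<in> set p"
    "last (map snd p) = v" by auto
qed

lemma tl_pawalk_verts: "pcas u p v \<Longrightarrow> tl (pawalk_verts u p) = map snd p"
proof (induction p arbitrary: u)
  case (Cons e es)
  then show ?case by (cases es) auto
qed simp

text \<open>The converse translation: the final arc leads to \<open>v\<close>, so that
  \<open>v = hd xs\<close> closes the list of vertices to a cycle.\<close>

fun walk_arcs :: "'n list \<Rightarrow> 'n \<Rightarrow> ('n \<times> 'n) list" where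
  "walk_arcs [] v = []"
| "walk_arcs [x] v = [(x, v)]"
| "walk_arcs (x # y # xs) v = (x, y) # walk_arcs (y # xs) v"

lemma walk_arcs:
  assumes "xs \<noteq> []"
  shows "pcas (hd xs) (walk_arcs xs v) v" "length (walk_arcs xs v) = length xs"
    "pawalk_verts (hd xs) (walk_arcs xs v) = xs @ [v]"
  using assms by (induction xs v rule: walk_arcs.induct) auto

lemma set_walk_arcs:
  assumes "successively (\<lambda>u v. (u, v) \<in> E) xs" "(last xs, v) \<in> E"
  shows "set (walk_arcs xs v) \<subseteq> E"
  using assms by (induction xs v rule: walk_arcs.induct) auto

lemma acyclic_on_iff:
  assumes "pair_wf_digraph T"
  shows "acyclic_on (parcs T) (pverts T) \<longleftrightarrow>
    \<not> (\<exists>p. pre_digraph.cycle (with_proj T) p \<and> 3 \<le> length p)"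
proof -
  interpret pair_wf_digraph T by fact
  show ?thesis
  proof (intro iffI notI)
    assume "acyclic_on (parcs T) (pverts T)" and "\<exists>p. cycle p \<and> 3 \<le> length p"
    then obtain p u where p: "awalk u p u" "distinct (tl (pawalk_verts u p))" "3 \<le> length p"
      by (auto simp: cycle_def)
    then have c: "set p \<subseteq> parcs T" "pcas u p u" "p \<noteq> []" by (auto simp: awalk_def)
    note m = pcas_map_snd[OF c(2,3)]
    have "set (map snd p) \<subseteq> pverts T" using c(1) by (auto dest!: subsetD in_arcsD2)
    moreover have "distinct (map snd p)" using p(2) c(2) by (simp add: tl_pawalk_verts)
    moreover have "successively (\<lambda>u v. (u, v) \<in> parcs T) (map snd p)"
      by (rule successively_mono[OF m(1)]) (use c(1) in auto)
    moreover have "(last (map snd p), hd (map snd p)) \<in> parcs T" using m c(1) by auto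
    ultimately show False
      using \<open>acyclic_on _ _\<close> p(3) unfolding acyclic_on_def by (metis length_map)
  next
    assume n: "\<not> (\<exists>p. cycle p \<and> 3 \<le> length p)"
    show "acyclic_on (parcs T) (pverts T)"
      unfolding acyclic_on_def
    proof (rule notI, elim exE conjE)
      fix xs assume xs: "set xs \<subseteq> pverts T" "distinct xs" "3 \<le> length xs"
        "successively (\<lambda>u v. (u, v) \<in> parcs T) xs" "(last xs, hd xs) \<in> parcs T"
      then have "xs \<noteq> []" by auto
      let ?p = "walk_arcs xs (hd xs)"
      note w = walk_arcs[OF \<open>xs \<noteq> []\<close>, of "hd xs"]
      have "awalk (hd xs) ?p (hd xs)"
        using w(1) set_walk_arcs[OF xs(4,5)] xs(1) \<open>xs \<noteq> []\<close> by (auto simp: awalk_def)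
      moreover have "distinct (tl (pawalk_verts (hd xs) ?p))"
        unfolding w(3) using xs(2) by (cases xs) auto
      moreover have "?p \<noteq> []" using w(2) \<open>xs \<noteq> []\<close> by auto
      ultimately have "cycle ?p" unfolding cycle_def by blast
      then show False using n w(2) xs(3) by auto
    qed
  qed
qed

section \<open>From rooted decompositions to tree-decompositions\<close>

definition parent_graph :: "nat \<Rightarrow> (nat \<Rightarrow> nat) \<Rightarrow> nat pair_pre_digraph" where
  "parent_graph n p = \<lparr>pverts = {..<n},
     parcs = {(i, j). i < n \<and> j < n \<and> (0 < i \<and> j = p i \<or> 0 < j \<and> i = p j)}\<rparr>"

lemma parent_graph_simps [simp]:
  "pverts (parent_graph n p) = {..<n}"
  "parcs (parent_graph n p) = {(i, j). i < n \<and> j < n \<and> (0 < i \<and> j = p i \<or> 0 < j \<and> i = p j)}"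
  by (simp_all add: parent_graph_def)

lemma pair_graph_parent_graph:
  assumes "\<And>i. 0 < i \<Longrightarrow> i < n \<Longrightarrow> p i < i"
  shows "pair_graph (parent_graph n p)"
proof
  show "finite (parcs (parent_graph n p))"
    by (rule finite_subset[of _ "{..<n} \<times> {..<n}"]) auto
  show "symmetric (parent_graph n p)"
    by (auto simp: symmetric_def sym_def)
  show "fst e \<noteq> snd e" if "e \<in> parcs (parent_graph n p)" for e
    using that assms[of "fst e"] assms[of "snd e"] by auto
qed auto

text \<open>The largest vertex \<open>m\<close> of a cycle would have two distinct smaller
  neighbours, but its only smaller neighbour is \<open>p m\<close>.\<close>

lemma acyclic_parent_graph:
  assumes p: "\<And>i. 0 < i \<Longrightarrow> i < n \<Longrightarrow> p i < i"
  shows "acyclic_on (parcs (parent_graph n p)) {..<n}"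
  unfolding acyclic_on_def
proof (rule notI, elim exE conjE)
  let ?E = "parcs (parent_graph n p)"
  fix xs assume xs: "set xs \<subseteq> {..<n}" "distinct xs" "3 \<le> length xs"
    "successively (\<lambda>u v. (u, v) \<in> ?E) xs" "(last xs, hd xs) \<in> ?E"
  have sym: "(a, b) \<in> ?E \<longleftrightarrow> (b, a) \<in> ?E" for a b by auto
  have par: "b = p a" if "(a, b) \<in> ?E" "b < a" for a b
    using that p[of b] by auto
  define m where "m = Max (set xs)"
  have "xs \<noteq> []" using xs(3) by auto
  then have m: "m \<in> set xs" "\<And>x. x \<in> set xs \<Longrightarrow> x \<le> m" unfolding m_def by auto
  then obtain ys zs where d: "xs = ys @ m # zs" by (meson split_list)
  have s: "successively (\<lambda>u v. (u, v) \<in> ?E) (ys @ m # zs)" using xs(4) d by simp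
  \<comment> \<open>The two neighbours of \<open>m\<close> on the cycle. If \<open>m\<close> stands
    at an end of the list, the closing arc from \<open>last xs\<close> to \<open>hd xs\<close>
    supplies one of them; length at least 3 makes them distinct.\<close>
  have "\<exists>a b. (a, m) \<in> ?E \<and> (m, b) \<in> ?E \<and> a \<in> set xs \<and> b \<in> set xs \<and> a \<noteq> b"
  proof (cases ys rule: rev_cases)
    case Nil
    with xs(3) d obtain b zs' where z: "zs = b # zs'" "zs' \<noteq> []" by (cases zs) fastforce+
    have "(last xs, m) \<in> ?E" using xs(5) d Nil by simp
    moreover have "(m, b) \<in> ?E" using s Nil z by (simp del: parent_graph_simps)
    moreover have "last xs \<in> set zs'" "b \<in> set xs" using z d Nil by auto
    moreover have "b \<notin> set zs'" using xs(2) d z by auto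
    ultimately show ?thesis using \<open>xs \<noteq> []\<close> last_in_set by metis
  next
    case (snoc ys' a)
    have am: "(a, m) \<in> ?E" using s snoc by (simp add: successively_append_iff del: parent_graph_simps)
    show ?thesis
    proof (cases zs)
      case Nil
      then have "ys' \<noteq> []" using xs(3) d snoc by auto
      moreover have "(m, hd ys') \<in> ?E" using xs(5) d Nil snoc calculation
        by (simp del: parent_graph_simps)
      moreover have "a \<noteq> hd ys'" "hd ys' \<in> set xs" "a \<in> set xs"
        using \<open>ys' \<noteq> []\<close> xs(2) d snoc by auto
      ultimately show ?thesis using am by metis
    next
      case (Cons b zs')
      then have "(m, b) \<in> ?E" using s by (simp add: successively_append_iff del: parent_graph_simps)
      moreover have "a \<noteq> b" "a \<in> set xs" "b \<in> set xs" using xs(2) d snoc Cons by auto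
      ultimately show ?thesis using am by metis
    qed
  qed
  then obtain a b where ab: "(a, m) \<in> ?E" "(m, b) \<in> ?E" "a \<in> set xs" "b \<in> set xs" "a \<noteq> b"
    by blast
  have "c < m" if "(m, c) \<in> ?E" "c \<in> set xs" for c
    using m(2)[OF that(2)] that(1) p[of m] by (cases "c = m") auto
  moreover have "(m, a) \<in> ?E" using ab(1) sym by blast
  ultimately show False using par[of m a] par[of m b] ab by metis
qed

text \<open>Going from a node of \<open>S\<close> to its parent stays in \<open>S\<close> and
  decreases the number, so it ends at the least node \<open>m\<close>.\<close>

lemma connected_parent_graph:
  assumes p: "\<And>i. 0 < i \<Longrightarrow> i < n \<Longrightarrow> p i < i"
    and "S \<subseteq> {..<n}" "m \<in> S" "\<And>i. i \<in> S \<Longrightarrow> i \<noteq> m \<Longrightarrow> m < i \<and> p i \<in> S"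
  shows "connected_on (parcs (parent_graph n p)) S"
proof -
  let ?E = "parcs (parent_graph n p) \<inter> S \<times> S"
  have sym: "sym (?E\<^sup>*)"
    by (rule sym_rtrancl) (auto simp: sym_def)
  have "(i, m) \<in> ?E\<^sup>*" if "i \<in> S" for i
    using that
  proof (induction i rule: less_induct)
    case (less i)
    show ?case
    proof (cases "i = m")
      case False
      then have i: "m < i" "p i \<in> S" "i < n" using assms(2,4) less.prems by auto
      then have "p i < i" using p by auto
      then have "(i, p i) \<in> ?E" using i less.prems by auto
      then show ?thesis using less.IH[OF \<open>p i < i\<close> \<open>p i \<in> S\<close>] by (rule converse_rtrancl_into_rtrancl)
    qed simp
  qed
  then have "(i, j) \<in> ?E\<^sup>*" if "i \<in> S" "j \<in> S" for i j
    using that sym by (meson rtrancl_trans symD)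
  then show ?thesis using \<open>m \<in> S\<close> by (auto simp: connected_on_def)
qed

text \<open>The nodes of a vertex \<open>v\<close> satisfy the hypotheses of
  \<open>connected_parent_graph\<close> with \<open>m\<close> the least of them: running
  intersection against the bag of \<open>m\<close> puts \<open>v\<close> into the bag of the
  parent.\<close>

lemma tree_decomposition_parent_graph:
  assumes r: "rooted_decomposition n p B"
    and "(\<Union>i<n. B i) = pverts G"
    and "\<And>v w. (v, w) \<in> parcs G \<Longrightarrow> \<exists>i<n. v \<in> B i \<and> w \<in> B i"
  shows "tree_decomposition (parent_graph n p) B G"
proof -
  let ?T = "parent_graph n p"
  have p: "p i < i" if "0 < i" "i < n" for i
    using r that by (auto simp: rooted_decomposition_def)
  have rip: "B i \<inter> B j \<subseteq> B (p i)" if "j < i" "i < n" for i j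
    using r that by (auto simp: rooted_decomposition_def)
  have "0 < n" using r by (auto simp: rooted_decomposition_def)
  have pg: "pair_graph ?T" using pair_graph_parent_graph p by blast
  then interpret pair_graph ?T .
  have sym: "sym (parcs ?T)" by (auto simp: sym_def)
  have wf: "pair_wf_digraph ?T" by unfold_locales
  have "connected_on (parcs ?T) {..<n}"
  proof (rule connected_parent_graph[where m = 0])
    fix i assume "i \<in> {..<n}" "i \<noteq> 0"
    then show "0 < i \<and> p i \<in> {..<n}" using p[of i] by simp
  qed (use p \<open>0 < n\<close> in simp_all)
  then have "connected (with_proj ?T)"
    using connected_induce_iff[OF sym, of "{..<n}"] induce_subgraph_pverts[OF wf] by simp
  moreover have "acyclic_on (parcs ?T) (pverts ?T)"
    using acyclic_parent_graph p by simp
  ultimately have tree: "undirected_tree ?T"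
    unfolding undirected_tree_def acyclic_on_iff[OF wf] using pg by blast
  have "bag_nodes ?T B v \<noteq> {} \<and> connected (with_proj ?T \<restriction> bag_nodes ?T B v)"
    if "v \<in> pverts G" for v
  proof -
    let ?S = "bag_nodes ?T B v"
    have S: "?S = {i. i < n \<and> v \<in> B i}" by (auto simp: bag_nodes_def)
    have ne: "?S \<noteq> {}" using that assms(2) unfolding S by auto
    define m where "m = (LEAST i. i \<in> ?S)"
    have m: "m \<in> ?S" "\<And>i. i \<in> ?S \<Longrightarrow> m \<le> i"
      using ne unfolding m_def by (auto intro: LeastI Least_le)
    have "connected_on (parcs ?T) ?S"
    proof (rule connected_parent_graph[where m = m])
      fix i assume i: "i \<in> ?S" "i \<noteq> m"
      then have "m < i" using m(2)[of i] by auto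
      moreover have "i < n" "v \<in> B i \<inter> B m" using i m(1) unfolding S by auto
      ultimately show "m < i \<and> p i \<in> ?S" using rip[of m i] p[of i] unfolding S by fastforce
    qed (use p m(1) in \<open>auto simp: S\<close>)
    then show ?thesis using ne connected_induce_iff[OF sym] by blast
  qed
  then show ?thesis
    unfolding tree_decomposition_def using tree assms(2,3) by fastforce
qed

section \<open>From trees to rooted decompositions, leaf by leaf\<close>

lemma exists_leaf:
  assumes "finite V" "sym E" "irrefl E" "acyclic_on E V" "a \<in> V" "b \<in> V" "(a, b) \<in> E"
  obtains l q where "l \<in> V" "q \<in> V" "(l, q) \<in> E" "\<And>c. c \<in> V \<Longrightarrow> (l, c) \<in> E \<Longrightarrow> c = q"
proof -
  define P where "P xs \<longleftrightarrow> set xs \<subseteq> V \<and> distinct xs \<and> successively (\<lambda>u v. (u, v) \<in> E) xs" for xs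
  have "length xs < Suc (card V)" if "P xs" for xs
    using that \<open>finite V\<close> by (metis P_def card_mono distinct_card less_Suc_eq_le)
  moreover have ab: "P [a, b]"
    using assms(3,5,6,7) by (auto simp: P_def irrefl_def)
  \<comment> \<open>A longest path; because of \<open>[a, b]\<close> it has at least two vertices. A
    neighbour of its first vertex \<open>l\<close> other than the second vertex \<open>q\<close>
    would prolong the path or, if it lies on it, close a cycle.\<close>
  ultimately obtain xs where xs: "P xs" "\<And>ys. P ys \<Longrightarrow> length ys \<le> length xs"
    using ex_has_greatest_nat[of P "[a, b]" length "Suc (card V)"] by blast
  from xs(2)[OF ab] obtain l q zs where l: "xs = l # q # zs"
    by (cases xs; cases "tl xs") auto
  have lq: "l \<in> V" "q \<in> V" "(l, q) \<in> E" using xs(1) l by (auto simp: P_def)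
  have "c = q" if c: "c \<in> V" "(l, c) \<in> E" for c
  proof (rule ccontr)
    assume "c \<noteq> q"
    have "c \<noteq> l" using c \<open>irrefl E\<close> by (auto simp: irrefl_def)
    have cl: "(c, l) \<in> E" using c \<open>sym E\<close> by (auto dest: symD)
    have "\<not> P (c # xs)" using xs(2)[of "c # xs"] by auto
    then have "c \<in> set xs" using xs(1) c cl l by (auto simp: P_def)
    then have "c \<in> set zs" using \<open>c \<noteq> q\<close> \<open>c \<noteq> l\<close> l by auto
    then obtain ys ys' where ys: "zs = ys @ c # ys'" by (meson split_list)
    let ?c = "l # q # ys @ [c]"
    have "successively (\<lambda>u v. (u, v) \<in> E) (?c @ ys')" using xs(1) l ys by (simp add: P_def)
    then have "successively (\<lambda>u v. (u, v) \<in> E) ?c" using successively_append_iff by blast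
    moreover have "set ?c \<subseteq> V" "distinct ?c" "3 \<le> length ?c" "(last ?c, hd ?c) \<in> E"
      using xs(1) l ys cl by (auto simp: P_def)
    ultimately show False using assms(4) unfolding acyclic_on_def by blast
  qed
  then show ?thesis using that lq by blast
qed

lemma connected_on_leaf_neighbour:
  assumes "connected_on E S" "l \<in> S" "v \<in> S" "v \<noteq> l" "\<And>c. c \<in> S \<Longrightarrow> (l, c) \<in> E \<Longrightarrow> c = q"
  shows "q \<in> S" "(l, q) \<in> E"
proof -
  have "(l, v) \<in> (E \<inter> S \<times> S)\<^sup>*" using assms by (auto simp: connected_on_def)
  then obtain y where "(l, y) \<in> E \<inter> S \<times> S" using \<open>v \<noteq> l\<close> by (metis converse_rtranclE)
  then show "q \<in> S" "(l, q) \<in> E" using assms(5) by auto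
qed

text \<open>A walk between other nodes enters and leaves \<open>l\<close> through \<open>q\<close>,
  so the visit can be cut out. In the induction, the shortened walk waits at \<open>q\<close> while
  the original one stands at \<open>l\<close>.\<close>

lemma connected_on_remove_leaf:
  assumes "connected_on E S" "sym E" "S - {l} \<noteq> {}" "\<And>c. c \<in> S \<Longrightarrow> (l, c) \<in> E \<Longrightarrow> c = q"
  shows "connected_on E (S - {l})"
proof -
  let ?E = "E \<inter> (S - {l}) \<times> (S - {l})"
  have "(v \<noteq> l \<longrightarrow> (u, v) \<in> ?E\<^sup>*) \<and> (v = l \<longrightarrow> (u, q) \<in> ?E\<^sup>*)"
    if "u \<in> S" "u \<noteq> l" "(u, v) \<in> (E \<inter> S \<times> S)\<^sup>*" for u v
    using that(3)
  proof (induction rule: rtrancl_induct)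
    case (step y z)
    have yz: "(y, z) \<in> E" "y \<in> S" "z \<in> S" "(z, y) \<in> E" using step(2) \<open>sym E\<close> by (auto dest: symD)
    show ?case
    proof (cases "y = l")
      case True
      then have "z = q" using assms(4) yz by auto
      then show ?thesis using step.IH True by auto
    next
      case y: False
      show ?thesis
      proof (cases "z = l")
        case True
        then have "y = q" using assms(4) yz by auto
        then show ?thesis using step.IH True y by auto
      next
        case False
        then have "(y, z) \<in> ?E" using y yz by auto
        then show ?thesis using step.IH False y by (meson rtrancl.rtrancl_into_rtrancl)
      qed
    qed
  qed (use that in auto)
  then show ?thesis using assms(1,3) by (auto simp: connected_on_def)
qed

text \<open>Without a leaf, the tree and the node sets of the vertices stay connected, so the rest
  is numbered by induction; the leaf gets the largest number, and its neighbour becomes its parent.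
  The empty case is there for vertices that no remaining bag contains.\<close>

lemma rooted_decomposition_of_tree:
  fixes B :: "'n \<Rightarrow> 'a set"
  assumes "finite V" "sym E" "irrefl E" "acyclic_on E V" "connected_on E V"
    and "\<And>v. {x \<in> V. v \<in> B x} = {} \<or> connected_on E {x \<in> V. v \<in> B x}"
  shows "\<exists>\<sigma> p. bij_betw \<sigma> {..<card V} V \<and> rooted_decomposition (card V) p (B \<circ> \<sigma>)"
  using assms(1,4,5,6)
proof (induction "card V" arbitrary: V)
  case 0
  then show ?case by (auto simp: connected_on_def)
next
  case (Suc n)
  show ?case
  proof (cases "n = 0")
    case True
    then obtain x where "V = {x}" using Suc.hyps(2) by (metis One_nat_def card_1_singletonE)
    then have "bij_betw (\<lambda>_. x) {..<card V} V \<and> rooted_decomposition (card V) id (B \<circ> (\<lambda>_. x))"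
      by (auto simp: bij_betw_def inj_on_def rooted_decomposition_def)
    then show ?thesis by blast
  next
    case False
    have "\<not> (\<exists>x. V \<subseteq> {x})" using Suc.hyps(2) False card_mono[of "{_}" V] by fastforce
    then obtain a b where ab: "a \<in> V" "b \<in> V" "a \<noteq> b" by blast
    then have "(a, b) \<in> (E \<inter> V \<times> V)\<^sup>*" using Suc.prems(3) by (auto simp: connected_on_def)
    then obtain c where "(a, c) \<in> E \<inter> V \<times> V" using ab by (metis converse_rtranclE)
    then obtain l q where l: "l \<in> V" "q \<in> V" "(l, q) \<in> E"
      and leaf: "\<And>c. c \<in> V \<Longrightarrow> (l, c) \<in> E \<Longrightarrow> c = q"
      using exists_leaf[OF Suc.prems(1) assms(2,3) Suc.prems(2)] by blast
    have "l \<noteq> q" using l assms(3) by (auto simp: irrefl_def)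
    let ?V = "V - {l}"
    have card: "card V = Suc n" "card ?V = n" using Suc.hyps(2) l Suc.prems(1) by auto
    have conn: "{x \<in> ?V. v \<in> B x} = {} \<or> connected_on E {x \<in> ?V. v \<in> B x}" for v
    proof (cases "{x \<in> ?V. v \<in> B x} = {}")
      case False
      then have "connected_on E {x \<in> V. v \<in> B x}" using Suc.prems(4)[of v] by auto
      moreover have eq: "{x \<in> ?V. v \<in> B x} = {x \<in> V. v \<in> B x} - {l}" by auto
      ultimately show ?thesis
        unfolding eq using connected_on_remove_leaf[OF _ assms(2), of _ l q] leaf False eq by auto
    qed simp
    have "acyclic_on E ?V" using Suc.prems(2) unfolding acyclic_on_def by blast
    moreover have "connected_on E ?V"
      by (rule connected_on_remove_leaf[OF Suc.prems(3) assms(2) _ leaf]) (use l \<open>l \<noteq> q\<close> in auto)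
    ultimately obtain \<sigma> p where \<sigma>: "bij_betw \<sigma> {..<n} ?V" and p: "rooted_decomposition n p (B \<circ> \<sigma>)"
      using Suc.hyps(1)[of ?V] card conn Suc.prems(1) by auto
    obtain i\<^sub>q where iq: "i\<^sub>q < n" "\<sigma> i\<^sub>q = q"
      using \<sigma> l \<open>l \<noteq> q\<close> by (metis DiffI bij_betw_def imageE lessThan_iff singletonD)
    let ?\<sigma> = "\<sigma>(n := l)" and ?p = "p(n := i\<^sub>q)"
    have "bij_betw ?\<sigma> {..<n} ?V" using \<sigma> by (rule bij_betw_cong[THEN iffD1, rotated]) auto
    then have "bij_betw ?\<sigma> (insert n {..<n}) (insert l ?V)"
      by (rule bij_betw_combine[of _ _ _ "{n}" "{l}", simplified]) auto
    moreover have "insert n {..<n} = {..<card V}" "insert l ?V = V" using card l by auto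
    ultimately have "bij_betw ?\<sigma> {..<card V} V" by simp
    moreover have "rooted_decomposition (card V) ?p (B \<circ> ?\<sigma>)"
      unfolding rooted_decomposition_def
    proof (intro conjI allI impI)
      fix i assume "0 < i \<and> i < card V"
      then show "?p i < i" using p iq card by (auto simp: rooted_decomposition_def less_Suc_eq)
    next
      fix i j assume ij: "j < i \<and> i < card V"
      show "(B \<circ> ?\<sigma>) i \<inter> (B \<circ> ?\<sigma>) j \<subseteq> (B \<circ> ?\<sigma>) (?p i)"
      proof (cases "i = n")
        case True
        then have "\<sigma> j \<in> ?V" using ij \<sigma> by (auto simp: bij_betw_def)
        \<comment> \<open>A vertex in the bag of \<open>l\<close> and in another bag occupies a
          connected set of nodes that reaches beyond \<open>l\<close>, hence contains the only
          neighbour \<open>q\<close> of \<open>l\<close>.\<close>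
        have "v \<in> B q" if "v \<in> B l" "v \<in> B (\<sigma> j)" for v
        proof -
          have "connected_on E {x \<in> V. v \<in> B x}" using Suc.prems(4)[of v] l that by auto
          from connected_on_leaf_neighbour(1)[OF this, of l "\<sigma> j" q]
          show ?thesis using that l \<open>\<sigma> j \<in> ?V\<close> leaf by blast
        qed
        then show ?thesis using True ij iq by auto
      next
        case False
        then have i: "i < n" "0 < i" using ij card by auto
        then have "p i < i" using p by (auto simp: rooted_decomposition_def)
        moreover have "(B \<circ> \<sigma>) i \<inter> (B \<circ> \<sigma>) j \<subseteq> (B \<circ> \<sigma>) (p i)"
          using p ij i by (auto simp: rooted_decomposition_def)
        ultimately show ?thesis using i ij by auto
      qed
    qed (use card in auto)
    ultimately show ?thesis by blast
  qed
qed

subsection \<open>Balanced separators\<close>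

text \<open>The guard \<open>0 < i\<close> stops the ascent at the root, where \<open>p\<close> has
  an arbitrary value.\<close>

inductive descendant :: "(nat \<Rightarrow> nat) \<Rightarrow> nat \<Rightarrow> nat \<Rightarrow> bool" for p x where
  self: "descendant p x x"
| child: "0 < i \<Longrightarrow> descendant p x (p i) \<Longrightarrow> descendant p x i"

section \<open>Cutting a weighted tree at one or two nodes\<close>

context
  fixes p :: "nat \<Rightarrow> nat" and n :: nat
  assumes parent: "\<forall>i. 0 < i \<and> i < n \<longrightarrow> p i < i"
begin

lemma parent_less: "0 < i \<Longrightarrow> i < n \<Longrightarrow> p i < i"
  using parent by blast

lemma descendant_le: "descendant p x i \<Longrightarrow> i < n \<Longrightarrow> x \<le> i"
proof (induction rule: descendant.induct)
  case (child i)
  then show ?case using parent_less[of i] by auto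
qed simp

lemma descendant_parent_iff:
  assumes "0 < i" "i \<noteq> x"
  shows "descendant p x i \<longleftrightarrow> descendant p x (p i)"
  using assms by (auto elim: descendant.cases intro: descendant.child)

lemma descendant_comparable:
  "descendant p x i \<Longrightarrow> descendant p y i \<Longrightarrow> descendant p x y \<or> descendant p y x"
proof (induction rule: descendant.induct)
  case (child i)
  then show ?case by (metis descendant.simps)
qed simp

lemma descendant_child:
  "descendant p x i \<Longrightarrow> i < n \<Longrightarrow> i \<noteq> x \<Longrightarrow> \<exists>c. 0 < c \<and> c < n \<and> p c = x \<and> descendant p c i"
proof (induction rule: descendant.induct)
  case (child i)
  show ?case
  proof (cases "p i = x")
    case True
    then show ?thesis using child by (auto intro: descendant.self)
  next
    case False
    then show ?thesis
      using child parent_less[of i] by (metis descendant.child less_trans)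
  qed
qed simp

text \<open>Nodes above a common \<open>i\<close> are comparable, but a child of \<open>x\<close>
  below another child of \<open>x\<close> would put \<open>x\<close> below its own child, against
  the numbering.\<close>

lemma descendant_child_unique:
  assumes "descendant p c i" "descendant p c' i" "p c = x" "p c' = x" "0 < c" "0 < c'" "c < n" "c' < n"
  shows "c = c'"
proof -
  have "a = b" if d: "descendant p a b" and "p a = x" "p b = x" "0 < a" "0 < b" "a < n" "b < n" for a b
  proof (rule ccontr)
    assume "a \<noteq> b"
    then have "descendant p a x" using descendant_parent_iff[of b a] d that by auto
    then show False using descendant_le[of a x] parent_less[of a] that by auto
  qed
  then show ?thesis using descendant_comparable[OF assms(1,2)] assms(3-) by metis
qed

text \<open>\<open>D\<close> is the subtree at a lowest node \<open>x\<close> for which it weighs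
  more than \<open>t\<close>, so the subtrees at the children of \<open>x\<close> weigh at most
  \<open>t\<close>. Labels stand for these child subtrees: they are constant along edges of
  \<open>D\<close> that avoid \<open>x\<close>, and only the edge from \<open>x\<close> to its
  parent can leave \<open>D\<close>.\<close>

lemma tree_cut:
  fixes w :: "nat \<Rightarrow> nat"
  assumes "t < (\<Sum>i<n. w i)"
  shows "\<exists>x D (label :: nat \<Rightarrow> nat). x < n \<and> D \<subseteq> {..<n} \<and> t < (\<Sum>i\<in>D. w i) \<and>
    (\<forall>i. 0 < i \<longrightarrow> i < n \<longrightarrow> i \<noteq> x \<longrightarrow> i \<in> D \<longleftrightarrow> p i \<in> D) \<and>
    (\<forall>i. i \<in> D \<longrightarrow> i \<noteq> x \<longrightarrow> p i \<noteq> x \<longrightarrow> label (p i) = label i) \<and>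
    (\<forall>a. (\<Sum>i | i \<in> D \<and> i \<noteq> x \<and> label i = a. w i) \<le> t)"
proof -
  define D where "D x = {i. i < n \<and> descendant p x i}" for x
  have fin: "finite (D x)" for x by (auto simp: D_def)
  have "descendant p 0 i" if "i < n" for i
    using that
  proof (induction i rule: less_induct)
    case (less i)
    then show ?case using parent_less[of i] by (cases "i = 0") (auto intro: descendant.intros)
  qed
  then have "D 0 = {..<n}" by (auto simp: D_def)
  then have D0: "t < (\<Sum>i\<in>D 0. w i)" using assms by simp
  then have "0 < n" using assms by (cases n) auto
  \<comment> \<open>Children have larger numbers, so all subtrees below the largest heavy node are light.\<close>
  define x where "x = Max {x. x < n \<and> t < (\<Sum>i\<in>D x. w i)}"
  have "x \<in> {x. x < n \<and> t < (\<Sum>i\<in>D x. w i)}"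
    unfolding x_def using D0 \<open>0 < n\<close> by (intro Max_in) auto
  then have x: "x < n" "t < (\<Sum>i\<in>D x. w i)" by auto
  have max: "(\<Sum>i\<in>D c. w i) \<le> t" if "x < c" "c < n" for c
  proof (rule ccontr)
    assume "\<not> ?thesis"
    then have "c \<le> x" unfolding x_def using that by (intro Max_ge) auto
    then show False using that by simp
  qed
  \<comment> \<open>The child of \<open>x\<close> whose subtree contains \<open>i\<close>; the value
    is meaningful only on \<open>D x\<close> without \<open>x\<close>.\<close>
  define label where "label i = (SOME c. 0 < c \<and> c < n \<and> p c = x \<and> descendant p c i)" for i
  have label: "0 < label i" "label i < n" "p (label i) = x" "descendant p (label i) i"
    if "i \<in> D x" "i \<noteq> x" for i
    using someI_ex[OF descendant_child[of x i]] that unfolding label_def D_def by auto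
  show ?thesis
  proof (intro exI[of _ x] exI[of _ "D x"] exI[of _ label] conjI allI impI)
    fix i assume i: "0 < i" "i < n" "i \<noteq> x"
    then show "i \<in> D x \<longleftrightarrow> p i \<in> D x"
      using descendant_parent_iff[of i x] parent_less[of i] by (auto simp: D_def)
  next
    fix i assume i: "i \<in> D x" "i \<noteq> x" "p i \<noteq> x"
    then have "i < n" "0 < i"
      by (auto simp: D_def elim: descendant.cases intro!: gr0I dest!: descendant_le)
    then have pi: "p i \<in> D x"
      using i descendant_parent_iff[of i x] parent_less[of i] by (auto simp: D_def)
    note lp = label[OF pi \<open>p i \<noteq> x\<close>] and li = label[OF i(1,2)]
    have "descendant p (label (p i)) i" using lp(4) \<open>0 < i\<close> by (auto intro: descendant.child)
    then show "label (p i) = label i"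
      using descendant_child_unique[OF _ li(4)] lp li by metis
  next
    fix a
    let ?A = "{i. i \<in> D x \<and> i \<noteq> x \<and> label i = a}"
    show "sum w ?A \<le> t"
    proof (cases "?A = {}")
      case False
      then have a: "0 < a" "a < n" "p a = x" using label by auto
      have "?A \<subseteq> D a" using label(4) by (auto simp: D_def)
      then have "sum w ?A \<le> sum w (D a)" using fin by (intro sum_mono2) auto
      also have "\<dots> \<le> t" using max parent_less a by metis
      finally show ?thesis .
    qed (simp only: sum.empty le0)
  qed (use x in \<open>auto simp: D_def\<close>)
qed

text \<open>The first cut takes off a set heavier than \<open>t\<close>. If more than
  \<open>t\<close> remains, a second cut takes more than \<open>t\<close> of that, and less than
  \<open>t\<close> of the total \<open>3 * t\<close> is left. The first component of a label tells
  these regions apart, the second the parts within a region.\<close>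

lemma tree_two_cuts:
  fixes w :: "nat \<Rightarrow> nat"
  assumes "(\<Sum>i<n. w i) \<le> 3 * t" "0 < n"
  shows "\<exists>x y (label :: nat \<Rightarrow> nat \<times> nat). x < n \<and> y < n \<and>
    (\<forall>i. 0 < i \<longrightarrow> i < n \<longrightarrow> i \<notin> {x, y} \<longrightarrow> p i \<notin> {x, y} \<longrightarrow> label (p i) = label i) \<and>
    (\<forall>a. (\<Sum>i | i < n \<and> i \<notin> {x, y} \<and> label i = a. w i) \<le> t)"
proof (cases "(\<Sum>i<n. w i) \<le> t")
  case True
  show ?thesis
  proof (intro exI[of _ 0] exI[of _ 0] exI[of _ "\<lambda>_. (0, 0)"] conjI allI impI)
    fix a
    have "(\<Sum>i | i < n \<and> i \<notin> {0, 0} \<and> (0, 0) = a. w i) \<le> (\<Sum>i<n. w i)"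
      by (intro sum_mono2) auto
    then show "(\<Sum>i | i < n \<and> i \<notin> {0, 0} \<and> (0, 0) = a. w i) \<le> t" using True by simp
  qed (use assms(2) in auto)
next
  case False
  then have "t < (\<Sum>i<n. w i)" by simp
  then obtain x D and l :: "nat \<Rightarrow> nat" where x: "x < n" "D \<subseteq> {..<n}" "t < sum w D"
    "\<forall>i. 0 < i \<longrightarrow> i < n \<longrightarrow> i \<noteq> x \<longrightarrow> i \<in> D \<longleftrightarrow> p i \<in> D"
    "\<forall>i. i \<in> D \<longrightarrow> i \<noteq> x \<longrightarrow> p i \<noteq> x \<longrightarrow> l (p i) = l i"
    "\<forall>a. (\<Sum>i | i \<in> D \<and> i \<noteq> x \<and> l i = a. w i) \<le> t"
    by (rule tree_cut[elim_format]) (elim exE conjE, rule that)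
  have split: "(\<Sum>i<n. w i) = sum w D + sum w ({..<n} - D)"
    using x(2) by (metis add.commute finite_lessThan sum.subset_diff)
  show ?thesis
  proof (cases "sum w ({..<n} - D) \<le> t")
    case True
    let ?l = "\<lambda>i. if i \<in> D then (0 :: nat, l i) else (1, 0 :: nat)"
    show ?thesis
    proof (intro exI[of _ x] exI[of _ x] exI[of _ ?l] conjI allI impI)
      fix i assume "0 < i" "i < n" "i \<notin> {x, x}" "p i \<notin> {x, x}"
      then show "?l (p i) = ?l i" using x(4)[rule_format, of i] x(5)[rule_format, of i] by auto
    next
      fix a :: "nat \<times> nat"
      let ?A = "{i. i < n \<and> i \<notin> {x, x} \<and> ?l i = a}"
      show "sum w ?A \<le> t"
      proof (cases "fst a = 0")
        case True
        then have "?A \<subseteq> {i. i \<in> D \<and> i \<noteq> x \<and> l i = snd a}" by (auto split: if_splits)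
        moreover have "finite {i. i \<in> D \<and> i \<noteq> x \<and> l i = snd a}"
          using finite_subset[OF x(2)] by auto
        ultimately have "sum w ?A \<le> sum w {i. i \<in> D \<and> i \<noteq> x \<and> l i = snd a}"
          by (intro sum_mono2) auto
        then show ?thesis using x(6) le_trans by blast
      next
        case False
        then have "?A \<subseteq> {..<n} - D" by (auto split: if_splits)
        then have "sum w ?A \<le> sum w ({..<n} - D)" by (intro sum_mono2) auto
        then show ?thesis using \<open>sum w ({..<n} - D) \<le> t\<close> by simp
      qed
    qed (use x in auto)
  next
    case False
    \<comment> \<open>With weight zero on \<open>D\<close>, the second cut measures only what the
      first one left over.\<close>
    define w' where "w' i = (if i \<in> D then 0 else w i)" for i
    have w': "sum w' A = sum w (A - D)" if "finite A" for A
      unfolding w'_def using that by (simp add: sum.If_cases Diff_eq)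
    have "t < (\<Sum>i<n. w' i)" using False w' by simp
    then obtain y E and m :: "nat \<Rightarrow> nat" where y: "y < n" "E \<subseteq> {..<n}" "t < sum w' E"
      "\<forall>i. 0 < i \<longrightarrow> i < n \<longrightarrow> i \<noteq> y \<longrightarrow> i \<in> E \<longleftrightarrow> p i \<in> E"
      "\<forall>i. i \<in> E \<longrightarrow> i \<noteq> y \<longrightarrow> p i \<noteq> y \<longrightarrow> m (p i) = m i"
      "\<forall>a. (\<Sum>i | i \<in> E \<and> i \<noteq> y \<and> m i = a. w' i) \<le> t"
      by (rule tree_cut[elim_format]) (elim exE conjE, rule that)
    have fin: "finite D" "finite E" using x(2) y(2) finite_subset by blast+
    \<comment> \<open>The sets \<open>D\<close> and \<open>E\<close> may overlap. \<open>D\<close>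
      takes precedence, so \<open>E\<close> counts only outside \<open>D\<close>, in agreement with
      the weights \<open>w'\<close>.\<close>
    let ?l = "\<lambda>i. if i \<in> D then (0 :: nat, l i) else if i \<in> E then (1, m i) else (2, 0 :: nat)"
    show ?thesis
    proof (rule exI[of _ x], rule exI[of _ y], rule exI[of _ ?l], intro conjI allI impI)
      fix i assume "0 < i" "i < n" "i \<notin> {x, y}" "p i \<notin> {x, y}"
      then show "?l (p i) = ?l i"
        using x(4)[rule_format, of i] x(5)[rule_format, of i] y(4)[rule_format, of i]
          y(5)[rule_format, of i] by auto
    next
      fix a :: "nat \<times> nat"
      let ?A = "{i. i < n \<and> i \<notin> {x, y} \<and> ?l i = a}"
      consider "fst a = 0" | "fst a = 1" | "fst a \<noteq> 0" "fst a \<noteq> 1" by blast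
      then show "sum w ?A \<le> t"
      proof cases
        case 1
        then have "?A \<subseteq> {i. i \<in> D \<and> i \<noteq> x \<and> l i = snd a}" by (auto split: if_splits)
        then have "sum w ?A \<le> sum w {i. i \<in> D \<and> i \<noteq> x \<and> l i = snd a}"
          using fin by (intro sum_mono2) auto
        then show ?thesis using x(6) le_trans by blast
      next
        case 2
        let ?C = "{i. i \<in> E \<and> i \<noteq> y \<and> m i = snd a}"
        have "?A \<subseteq> ?C - D" using 2 by (auto split: if_splits)
        then have "sum w ?A \<le> sum w (?C - D)" using fin by (intro sum_mono2) auto
        also have "\<dots> = sum w' ?C" using w'[of ?C] fin by simp
        finally show ?thesis using y(6) le_trans by blast
      next
        case 3
        \<comment> \<open>Of the total \<open>3 * t\<close>, more than \<open>t\<close> lies in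
          \<open>D\<close> and more than \<open>t\<close> in \<open>E - D\<close>.\<close>
        then have "?A \<subseteq> {..<n} - D - (E - D)" by (auto split: if_splits)
        then have "sum w ?A \<le> sum w ({..<n} - D - (E - D))" by (intro sum_mono2) auto
        moreover have "sum w ({..<n} - D) = sum w ({..<n} - D - (E - D)) + sum w (E - D)"
          using y(2) by (intro sum.subset_diff) auto
        moreover have "t < sum w (E - D)" using y(3) w' fin by simp
        ultimately show ?thesis using assms(1) split x(3) by linarith
      qed
    qed (use x y in auto)
  qed
qed

end

text \<open>Classes are merged as long as two of them have together at most \<open>t\<close>
  elements. If six classes were left, no two could be merged, and three disjoint pairs would have
  more than \<open>3 * t\<close> elements.\<close>

lemma merge_classes:
  fixes c :: "'a \<Rightarrow> 'b"
  assumes "finite Z" "card Z \<le> 3 * t" "\<And>a. card {z \<in> Z. c z = a} \<le> t"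
  obtains g :: "'b \<Rightarrow> nat" where "\<And>b. g b < 5" "\<And>a. card {z \<in> Z. g (c z) = a} \<le> t"
proof -
  define P where "P m g \<longleftrightarrow> (\<forall>b. g b \<le> m) \<and> (\<forall>a. card {z \<in> Z. g (c z) = a} \<le> t)"
    for m and g :: "'b \<Rightarrow> nat"
  obtain f :: "'b \<Rightarrow> nat" where f: "inj_on f (c ` Z)"
    using finite_imp_inj_to_nat_seg[of "c ` Z"] assms(1) by blast
  \<comment> \<open>Labels that do not occur are sent to \<open>0\<close>, so that \<open>f'\<close>
    is bounded on the whole type.\<close>
  define f' where "f' b = (if b \<in> c ` Z then f b else 0)" for b
  have "card {z \<in> Z. f' (c z) = a} \<le> t" for a
  proof (cases "{z \<in> Z. f' (c z) = a} = {}")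
    case False
    then obtain z where "z \<in> Z" "f (c z) = a" by (auto simp: f'_def)
    then have "{z \<in> Z. f' (c z) = a} = {z' \<in> Z. c z' = c z}"
      using f by (auto simp: f'_def inj_on_def)
    then show ?thesis using assms(3) by simp
  qed (simp only: card.empty le0)
  moreover have "f' b \<le> Max (insert 0 (f ` c ` Z))" for b
    using assms(1) by (auto simp: f'_def)
  ultimately have ex: "\<exists>m g. P m g" unfolding P_def by blast
  define m where "m = (LEAST m. \<exists>g. P m g)"
  from LeastI_ex[OF ex] obtain g where g: "P m g" unfolding m_def by blast
  have "m < 5"
  proof (rule ccontr)
    assume "\<not> m < 5"
    define Q where "Q a = {z \<in> Z. g (c z) = a}" for a
    have fin: "finite (Q a)" for a using assms(1) by (auto simp: Q_def)
    have merge: "t < card (Q a) + card (Q b)" if "a < b" "b \<le> m" for a b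
    proof (rule ccontr)
      assume "\<not> ?thesis"
      \<comment> \<open>Class \<open>b\<close> joins class \<open>a\<close>, and the top label
        \<open>m\<close> is renamed to the freed \<open>b\<close>, so \<open>m - 1\<close> bounds
        the new labels.\<close>
      define g' where "g' x = (if g x = b then a else if g x = m then b else g x)" for x
      have "card {z \<in> Z. g' (c z) = a'} \<le> t" for a'
      proof (cases "a' = a")
        case True
        then have "{z \<in> Z. g' (c z) = a'} \<subseteq> Q a \<union> Q b"
          using that by (auto simp: g'_def Q_def split: if_splits)
        then have "card {z \<in> Z. g' (c z) = a'} \<le> card (Q a \<union> Q b)" using fin by (intro card_mono) auto
        also have "\<dots> \<le> t" using card_Un_le[of "Q a" "Q b"] \<open>\<not> t < _\<close> by linarith
        finally show ?thesis .
      next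
        case False
        then have "{z \<in> Z. g' (c z) = a'} \<subseteq> Q (if a' = b then m else a')"
          by (auto simp: g'_def Q_def split: if_splits)
        then have "card {z \<in> Z. g' (c z) = a'} \<le> card (Q (if a' = b then m else a'))"
          using fin by (intro card_mono) auto
        also have "\<dots> \<le> t" using g unfolding P_def Q_def by blast
        finally show ?thesis .
      qed
      moreover have "g' x \<le> m - 1" for x
      proof -
        have "g x \<le> m" using g by (auto simp: P_def)
        then show ?thesis using that by (auto simp: g'_def)
      qed
      ultimately have "P (m - 1) g'" by (auto simp: P_def)
      then have "m \<le> m - 1" unfolding m_def by (metis (mono_tags, lifting) Least_le)
      then show False using that by auto
    qed
    have "(\<Sum>a<6. card (Q a)) = card (\<Union>a<6. Q a)"
      by (rule card_UN_disjoint[symmetric]) (use fin in \<open>auto simp: Q_def\<close>)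
    also have "\<dots> \<le> card Z" using assms(1) by (intro card_mono) (auto simp: Q_def)
    finally have "(\<Sum>a<6. card (Q a)) \<le> 3 * t" using assms(2) by simp
    moreover have "(\<Sum>a<6. card (Q a)) = card (Q 0) + card (Q 1) + card (Q 2) + card (Q 3) + card (Q 4) + card (Q 5)"
      by (simp add: eval_nat_numeral)
    ultimately show False
      using merge[of 0 1] merge[of 2 3] merge[of 4 5] \<open>\<not> m < 5\<close> by linarith
  qed
  then show ?thesis using g that[of g] by (auto simp: P_def intro: le_less_trans)
qed

text \<open>On the way up from \<open>i\<close> to the topmost node of \<open>v\<close>, all bags
  contain \<open>v\<close> by running intersection. So the way avoids \<open>x\<close> and
  \<open>y\<close>, and the label never changes: it belongs to \<open>v\<close> rather than to a
  node.\<close>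

lemma rooted_decomposition_label:
  assumes r: "rooted_decomposition n p B"
    and lab: "\<forall>i. 0 < i \<longrightarrow> i < n \<longrightarrow> i \<notin> {x, y} \<longrightarrow> p i \<notin> {x, y} \<longrightarrow> label (p i) = label i"
    and v: "v \<notin> B x" "v \<notin> B y" and i: "i < n" "v \<in> B i"
  shows "label i = label (LEAST j. v \<in> B j)"
  using i
proof (induction i rule: less_induct)
  case (less i)
  let ?h = "LEAST j. v \<in> B j"
  have h: "v \<in> B ?h" "?h \<le> i" using less.prems by (auto intro: LeastI Least_le)
  show ?case
  proof (cases "?h = i")
    case False
    then have "?h < i" using h by simp
    then have "v \<in> B (p i)" "p i < i"
      using r h less.prems by (fastforce simp: rooted_decomposition_def)+
    moreover have "label (p i) = label i"
      using lab[rule_format, of i] v less.prems \<open>?h < i\<close> calculation by auto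
    ultimately show ?thesis using less.IH[of "p i"] less.prems by auto
  qed simp
qed

text \<open>The tree is cut at two nodes, with \<open>Y\<close> as weight, and the two bags form
  \<open>S\<close>. All nodes of a vertex outside \<open>S\<close> have the same label, so vertices
  sharing a bag agree in it; merging the labels leaves five classes.\<close>

lemma balanced_separator:
  assumes r: "rooted_decomposition n p B" and B: "\<And>i. i < n \<Longrightarrow> card (B i) \<le> K"
    and "finite (\<Union>i<n. B i)" and Y: "finite Y" "card Y \<le> 3 * t" "Y \<subseteq> (\<Union>i<n. B i)"
  obtains S and c :: "'a \<Rightarrow> nat" where "finite S" "card S \<le> 2 * K" "\<And>v. c v < 5"
    "\<And>i u v. i < n \<Longrightarrow> u \<in> B i - S \<Longrightarrow> v \<in> B i - S \<Longrightarrow> c u = c v"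
    "\<And>a. card {y \<in> Y - S. c y = a} \<le> t"
proof -
  define h where "h v = (LEAST j. v \<in> B j)" for v
  \<comment> \<open>Each vertex of \<open>Y\<close> is charged to its topmost node only, so that the
    total weight is at most \<open>card Y\<close>.\<close>
  define w where "w i = card {v \<in> Y. h v = i}" for i
  have p: "\<forall>i. 0 < i \<and> i < n \<longrightarrow> p i < i"
    using r by (simp add: rooted_decomposition_def)
  have "0 < n" using r by (auto simp: rooted_decomposition_def)
  have h: "v \<in> B (h v)" "h v < n" if v: "v \<in> Y" for v
  proof -
    obtain i where "i < n" "v \<in> B i" using v Y(3) by blast
    then show "v \<in> B (h v)" "h v < n" unfolding h_def by (auto intro: LeastI le_less_trans[OF Least_le])
  qed
  have w: "sum w A = card {v \<in> Y. h v \<in> A}" if "finite A" for A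
  proof -
    have "sum w A = card (\<Union>i\<in>A. {v \<in> Y. h v = i})"
      unfolding w_def by (rule card_UN_disjoint[symmetric]) (use that Y(1) in auto)
    also have "(\<Union>i\<in>A. {v \<in> Y. h v = i}) = {v \<in> Y. h v \<in> A}" by auto
    finally show ?thesis .
  qed
  have "sum w {..<n} \<le> card Y" using w[of "{..<n}"] Y(1) by (auto intro: card_mono)
  then have "sum w {..<n} \<le> 3 * t" using Y(2) by simp
  from tree_two_cuts[OF p this \<open>0 < n\<close>] obtain x y and label :: "nat \<Rightarrow> nat \<times> nat" where xy: "x < n" "y < n"
    and lab: "\<forall>i. 0 < i \<longrightarrow> i < n \<longrightarrow> i \<notin> {x, y} \<longrightarrow> p i \<notin> {x, y} \<longrightarrow> label (p i) = label i"
    and wl: "\<forall>a. (\<Sum>i | i < n \<and> i \<notin> {x, y} \<and> label i = a. w i) \<le> t"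
    by (elim exE conjE) (rule that)
  define S where "S = B x \<union> B y"
  have "finite S" using xy assms(3) by (auto simp: S_def)
  have "card S \<le> 2 * K"
    unfolding S_def using card_Un_le[of "B x" "B y"] B[OF xy(1)] B[OF xy(2)] by linarith
  have "card {z \<in> Y - S. label (h z) = a} \<le> t" for a
  proof -
    have "{z \<in> Y - S. label (h z) = a} \<subseteq> {v \<in> Y. h v \<in> {i. i < n \<and> i \<notin> {x, y} \<and> label i = a}}"
      using h by (fastforce simp: S_def)
    then have "card {z \<in> Y - S. label (h z) = a}
      \<le> card {v \<in> Y. h v \<in> {i. i < n \<and> i \<notin> {x, y} \<and> label i = a}}"
      using Y(1) by (intro card_mono) auto
    also have "\<dots> \<le> t" using w[of "{i. i < n \<and> i \<notin> {x, y} \<and> label i = a}"]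
        wl[THEN spec, of a] by (simp del: insert_iff)
    finally show ?thesis .
  qed
  moreover have "card (Y - S) \<le> 3 * t" using Y card_mono[of Y "Y - S"] by auto
  ultimately obtain g :: "nat \<times> nat \<Rightarrow> nat" where g: "\<And>b. g b < 5"
    "\<And>a. card {z \<in> Y - S. g (label (h z)) = a} \<le> t"
    using merge_classes[of "Y - S" t "\<lambda>z. label (h z)"] Y(1) by (metis finite_Diff)
  show ?thesis
  proof (rule that[of S "\<lambda>v. g (label (h v))"])
    fix i u v assume "i < n" "u \<in> B i - S" "v \<in> B i - S"
    then have "label i = label (h u)" "label i = label (h v)"
      using rooted_decomposition_label[OF r lab] unfolding h_def S_def by auto
    then show "g (label (h u)) = g (label (h v))" by simp
  qed (use g \<open>finite S\<close> \<open>card S \<le> 2 * K\<close> in auto)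
qed

subsection \<open>Gluing decompositions at the root\<close>

definition children :: "nat \<Rightarrow> (nat \<Rightarrow> nat) \<Rightarrow> nat \<Rightarrow> nat set" where
  "children n p x = {i. 0 < i \<and> i < n \<and> p i = x}"

definition nodes_of :: "nat \<Rightarrow> (nat \<Rightarrow> 'a set) \<Rightarrow> 'a \<Rightarrow> nat set" where
  "nodes_of n B v = {i. i < n \<and> v \<in> B i}"

definition join_parent :: "nat \<Rightarrow> (nat \<Rightarrow> nat) \<Rightarrow> (nat \<Rightarrow> nat) \<Rightarrow> nat \<Rightarrow> nat" where
  "join_parent n p q i = (if i < n then p i else if i = n then 0 else n + q (i - n))"

definition join_bags :: "nat \<Rightarrow> (nat \<Rightarrow> 'b) \<Rightarrow> (nat \<Rightarrow> 'b) \<Rightarrow> nat \<Rightarrow> 'b" where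
  "join_bags n B C i = (if i < n then B i else C (i - n))"

lemma finite_children [simp]: "finite (children n p x)"
  by (simp add: children_def)

lemma finite_nodes_of [simp]: "finite (nodes_of n B v)"
  by (simp add: nodes_of_def)

lemma ex_join_iff: "(\<exists>i<n + m. P i) \<longleftrightarrow> (\<exists>i<n. P i) \<or> (\<exists>i<m. P (n + i))" for n m :: nat
  by (metis add_less_cancel_left le_add_diff_inverse less_or_eq_imp_le linorder_le_less_linear
      trans_less_add1)

lemma join_bags_simps [simp]:
  "i < n \<Longrightarrow> join_bags n B C i = B i" "join_bags n B C (n + i) = C i"
  by (auto simp: join_bags_def)

lemma UN_join_bags: "(\<Union>i<n + m. join_bags n B C i) = (\<Union>i<n. B i) \<union> (\<Union>i<m. C i)"
proof -
  have "v \<in> (\<Union>i<n + m. join_bags n B C i) \<longleftrightarrow> v \<in> (\<Union>i<n. B i) \<union> (\<Union>i<m. C i)" for v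
    using ex_join_iff[of n m "\<lambda>i. v \<in> join_bags n B C i"] by auto
  then show ?thesis by blast
qed

lemma nodes_of_join_bags:
  "nodes_of (n + m) (join_bags n B C) v = nodes_of n B v \<union> (+) n ` nodes_of m C v"
proof (intro set_eqI)
  fix i
  show "i \<in> nodes_of (n + m) (join_bags n B C) v \<longleftrightarrow> i \<in> nodes_of n B v \<union> (+) n ` nodes_of m C v"
  proof (cases "i < n")
    case False
    then obtain j where "i = n + j" by (metis le_iff_add linorder_not_less)
    then show ?thesis by (auto simp: nodes_of_def)
  qed (auto simp: nodes_of_def)
qed

lemma card_nodes_of_join_bags:
  "card (nodes_of (n + m) (join_bags n B C) v) = card (nodes_of n B v) + card (nodes_of m C v)"
  unfolding nodes_of_join_bags
  by (subst card_Un_disjoint) (auto simp: card_image nodes_of_def)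

text \<open>The second tree is numbered after the first and its root \<open>n\<close> hangs below
  the root \<open>0\<close>, so parents stay smaller. A vertex of both parts lies in both root bags,
  hence its nodes are linked across the new edge.\<close>

lemma rooted_decomposition_join:
  assumes r: "rooted_decomposition n p B" and s: "rooted_decomposition m q C"
    and int: "(\<Union>i<n. B i) \<inter> (\<Union>i<m. C i) \<subseteq> B 0 \<inter> C 0"
  shows "rooted_decomposition (n + m) (join_parent n p q) (join_bags n B C)"
  unfolding rooted_decomposition_def
proof (intro conjI allI impI)
  have pos: "0 < n" "0 < m" using r s by (auto simp: rooted_decomposition_def)
  then show "0 < n + m" by simp
  show "join_parent n p q i < i" if "0 < i \<and> i < n + m" for i
  proof -
    have "q (i - n) < i - n" if "n < i"
      using s that \<open>0 < i \<and> i < n + m\<close> by (auto simp: rooted_decomposition_def)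
    then show ?thesis
      using r that pos by (auto simp: rooted_decomposition_def join_parent_def)
  qed
  show "join_bags n B C i \<inter> join_bags n B C j \<subseteq> join_bags n B C (join_parent n p q i)"
    if ij: "j < i \<and> i < n + m" for i j
  proof -
    consider "i < n" | "i = n" | "n < i" "j < n" | "n < i" "n \<le> j" by linarith
    then show ?thesis
    proof cases
      case 1
      then have "p i < i" "B i \<inter> B j \<subseteq> B (p i)"
        using r ij by (auto simp: rooted_decomposition_def)
      then show ?thesis using 1 ij by (simp add: join_parent_def)
    next
      case 2
      then have "C 0 \<inter> B j \<subseteq> B 0" using int ij pos by blast
      then show ?thesis using 2 ij pos by (simp add: join_parent_def join_bags_def)
    next
      case 3
      define i' where "i' = i - n"
      with 3 have i': "i = n + i'" "0 < i'" "i' < m" using ij by auto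
      then have "C i' \<inter> B j \<subseteq> C 0" using int 3 by blast
      moreover have "C i' \<inter> C 0 \<subseteq> C (q i')"
        using s i' by (auto simp: rooted_decomposition_def)
      ultimately show ?thesis using 3 i' by (auto simp: join_parent_def)
    next
      case 4
      then obtain i' j' where i': "i = n + i'" "j = n + j'" using le_Suc_ex[of n i] le_Suc_ex[of n j] by auto
      then have "C i' \<inter> C j' \<subseteq> C (q i')"
        using s ij by (auto simp: rooted_decomposition_def)
      then show ?thesis using 4 i' by (auto simp: join_parent_def)
    qed
  qed
qed

lemma children_join_parent:
  assumes "rooted_decomposition n p B" "rooted_decomposition m q C"
  shows "x < n \<Longrightarrow> children (n + m) (join_parent n p q) x =
      (if x = 0 then insert n (children n p x) else children n p x)"
    and "children (n + m) (join_parent n p q) (n + x) = (+) n ` children m q x"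
proof -
  have pos: "0 < n" "0 < m" using assms by (auto simp: rooted_decomposition_def)
  show "children (n + m) (join_parent n p q) x =
      (if x = 0 then insert n (children n p x) else children n p x)" if "x < n"
    using pos that by (auto simp: children_def join_parent_def split: if_splits)
  show "children (n + m) (join_parent n p q) (n + x) = (+) n ` children m q x"
  proof (intro set_eqI iffI)
    fix i assume i: "i \<in> children (n + m) (join_parent n p q) (n + x)"
    have "p i < n" if "i < n" "0 < i"
      using assms(1) that by (auto simp: rooted_decomposition_def intro: less_trans)
    then have "n < i" "q (i - n) = x" "i < n + m"
      using i pos by (auto simp: children_def join_parent_def split: if_splits)
    then show "i \<in> (+) n ` children m q x"
      by (auto simp: children_def intro!: image_eqI[of _ _ "i - n"])
  qed (auto simp: children_def join_parent_def)
qed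

text \<open>The invariant of the recursion. Five children leave room for a parent, so that a root
  can later be hung below another node within degree 6. Vertices of \<open>R\<close> are charged for
  neighbours in \<open>U\<close> alone, which lets the bounds of several pieces be added;
  \<open>max 1\<close> covers those without such a neighbour, as they still lie in the root
  bag.\<close>

definition good_decomposition :: "('a \<Rightarrow> 'a set) \<Rightarrow> nat \<Rightarrow> 'a set \<Rightarrow> 'a set \<Rightarrow> bool" where
  "good_decomposition N b R U \<longleftrightarrow> (\<exists>n p B. rooted_decomposition n p B \<and>
     (\<Union>i<n. B i) = R \<union> U \<and> R \<subseteq> B 0 \<and>
     (\<forall>i<n. card (B i) \<le> b \<and> card (children n p i) \<le> 5) \<and>
     (\<forall>u\<in>U. \<forall>w\<in>N u \<inter> (R \<union> U). \<exists>i<n. u \<in> B i \<and> w \<in> B i) \<and>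
     (\<forall>u\<in>U. card (nodes_of n B u) \<le> card (N u \<inter> (R \<union> U)) + 1) \<and>
     (\<forall>v\<in>R. card (nodes_of n B v) \<le> max 1 (card (N v \<inter> U))))"

text \<open>The pieces are hung one after the other below a root with bag \<open>X\<close>, so
  \<open>m\<close> bounds the number of children of the root. Each piece contains only those
  vertices of \<open>X\<close> that have a neighbour in it.\<close>

lemma glue_decompositions:
  fixes N :: "'a \<Rightarrow> 'a set" and U :: "nat \<Rightarrow> 'a set"
  assumes X: "card X \<le> b"
    and fin: "\<And>v. finite (N v)"
    and disj: "\<And>i j. i < m \<Longrightarrow> j < i \<Longrightarrow> U i \<inter> U j = {}" "\<And>j. j < m \<Longrightarrow> U j \<inter> X = {}"
    and good: "\<And>j. j < m \<Longrightarrow> good_decomposition N b {v \<in> X. N v \<inter> U j \<noteq> {}} (U j)"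
    and sym: "\<And>u v. u \<in> N v \<Longrightarrow> v \<in> N u"
    and "m \<le> 5"
  shows "\<exists>n p B. rooted_decomposition n p B \<and> (\<Union>i<n. B i) = X \<union> (\<Union>j<m. U j) \<and> B 0 = X \<and>
    (\<forall>i<n. card (B i) \<le> b) \<and> card (children n p 0) \<le> m \<and>
    (\<forall>i<n. 0 < i \<longrightarrow> card (children n p i) \<le> 5) \<and>
    (\<forall>j<m. \<forall>u\<in>U j. \<forall>w\<in>N u \<inter> (X \<union> U j). \<exists>i<n. u \<in> B i \<and> w \<in> B i) \<and>
    (\<forall>j<m. \<forall>u\<in>U j. card (nodes_of n B u) \<le> card (N u \<inter> (X \<union> U j)) + 1) \<and>
    (\<forall>v\<in>X. card (nodes_of n B v) \<le> 1 + card (N v \<inter> (\<Union>j<m. U j)))"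
  using disj good \<open>m \<le> 5\<close>
proof (induction m)
  case 0
  have "rooted_decomposition (Suc 0) (\<lambda>i. i) (\<lambda>_. X)" by (auto simp: rooted_decomposition_def)
  moreover have "children (Suc 0) (\<lambda>i. i) 0 = {}" by (auto simp: children_def)
  moreover have "card (nodes_of (Suc 0) (\<lambda>_. X) v) \<le> 1" for v
    using card_mono[of "{0}" "nodes_of (Suc 0) (\<lambda>_. X) v"] by (auto simp: nodes_of_def)
  ultimately show ?case using X by (intro exI[of _ "Suc 0"] exI[of _ "\<lambda>i. i"] exI[of _ "\<lambda>_. X"]) auto
next
  case (Suc m)
  let ?R = "{v \<in> X. N v \<inter> U m \<noteq> {}}" and ?W = "\<Union>j<m. U j"
  have "\<exists>n p B. rooted_decomposition n p B \<and> (\<Union>i<n. B i) = X \<union> ?W \<and> B 0 = X \<and>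
    (\<forall>i<n. card (B i) \<le> b) \<and> card (children n p 0) \<le> m \<and>
    (\<forall>i<n. 0 < i \<longrightarrow> card (children n p i) \<le> 5) \<and>
    (\<forall>j<m. \<forall>u\<in>U j. \<forall>w\<in>N u \<inter> (X \<union> U j). \<exists>i<n. u \<in> B i \<and> w \<in> B i) \<and>
    (\<forall>j<m. \<forall>u\<in>U j. card (nodes_of n B u) \<le> card (N u \<inter> (X \<union> U j)) + 1) \<and>
    (\<forall>v\<in>X. card (nodes_of n B v) \<le> 1 + card (N v \<inter> ?W))"
  proof (rule Suc.IH)
    show "U i \<inter> U j = {}" if "i < m" "j < i" for i j
      using Suc.prems(1)[of i j] that by simp
    show "U j \<inter> X = {}" if "j < m" for j
      using Suc.prems(2)[of j] that by simp
    show "good_decomposition N b {v \<in> X. N v \<inter> U j \<noteq> {}} (U j)" if "j < m" for j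
      using Suc.prems(3)[of j] that by simp
  qed (use Suc.prems in simp)
  then obtain n p B where r: "rooted_decomposition n p B" "(\<Union>i<n. B i) = X \<union> ?W" "B 0 = X"
    and cB': "\<forall>i<n. card (B i) \<le> b" "card (children n p 0) \<le> m"
      "\<forall>i<n. 0 < i \<longrightarrow> card (children n p i) \<le> 5"
    and eB': "\<forall>j<m. \<forall>u\<in>U j. \<forall>w\<in>N u \<inter> (X \<union> U j). \<exists>i<n. u \<in> B i \<and> w \<in> B i"
    and uB': "\<forall>j<m. \<forall>u\<in>U j. card (nodes_of n B u) \<le> card (N u \<inter> (X \<union> U j)) + 1"
    and xB': "\<forall>v\<in>X. card (nodes_of n B v) \<le> 1 + card (N v \<inter> ?W)"
    by (elim exE conjE) (rule that)
  note cB = cB'[rule_format] and eB = eB'[rule_format] and uB = uB'[rule_format]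
    and xB = xB'[rule_format]
  have "good_decomposition N b ?R (U m)" using Suc.prems(3) by blast
  then obtain k q C where s: "rooted_decomposition k q C" "(\<Union>i<k. C i) = ?R \<union> U m" "?R \<subseteq> C 0"
    and cC': "\<forall>i<k. card (C i) \<le> b \<and> card (children k q i) \<le> 5"
    and eC': "\<forall>u\<in>U m. \<forall>w\<in>N u \<inter> (?R \<union> U m). \<exists>i<k. u \<in> C i \<and> w \<in> C i"
    and uC': "\<forall>u\<in>U m. card (nodes_of k C u) \<le> card (N u \<inter> (?R \<union> U m)) + 1"
    and xC': "\<forall>v\<in>?R. card (nodes_of k C v) \<le> max 1 (card (N v \<inter> U m))"
    unfolding good_decomposition_def by (elim exE conjE) (rule that)
  have cC: "card (C i) \<le> b" "card (children k q i) \<le> 5" if "i < k" for i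
    using cC' that by simp_all
  note eC = eC'[rule_format] and uC = uC'[rule_format]
  have xC: "card (nodes_of k C v) \<le> max 1 (card (N v \<inter> U m))" if "v \<in> ?R" for v
    using xC' that by blast
  have pos: "0 < n" "0 < k" using r(1) s(1) by (auto simp: rooted_decomposition_def)
  have dm: "U m \<inter> X = {}" "U m \<inter> ?W = {}" using Suc.prems(1)[of m] Suc.prems(2)[of m] by auto
  have zB: "card (nodes_of n B v) = 0" if "v \<notin> X \<union> ?W" for v
    using that r(2) by (auto simp: nodes_of_def)
  have zC: "card (nodes_of k C v) = 0" if "v \<notin> ?R \<union> U m" for v
  proof -
    have "v \<notin> (\<Union>i<k. C i)" using that s(2) by blast
    then show ?thesis by (auto simp: nodes_of_def)
  qed
  let ?p = "join_parent n p q" and ?B = "join_bags n B C"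
  have W: "(\<Union>j<Suc m. U j) = ?W \<union> U m" by (auto simp: less_Suc_eq)
  have nodes: "card (nodes_of (n + k) ?B v) = card (nodes_of n B v) + card (nodes_of k C v)" for v
    by (rule card_nodes_of_join_bags)
  have "(X \<union> ?W) \<inter> (?R \<union> U m) \<subseteq> B 0 \<inter> C 0"
    using dm s(3) unfolding r(3) by blast
  then have 1: "rooted_decomposition (n + k) ?p ?B"
    using rooted_decomposition_join[OF r(1) s(1)] r(2) s(2) by simp
  have 2: "(\<Union>i<n + k. ?B i) = X \<union> (\<Union>j<Suc m. U j)"
    unfolding UN_join_bags W r(2) s(2) by blast
  have 3: "?B 0 = X" using pos r(3) by simp
  have less_join: "P i" if "i < n + k" "\<And>i. i < n \<Longrightarrow> P i" "\<And>i. i < k \<Longrightarrow> P (n + i)" for P i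
    using that by (metis add_less_cancel_left le_add_diff_inverse linorder_not_less)
  have 4: "card (?B i) \<le> b" if "i < n + k" for i
    using that by (rule less_join) (auto simp: cB cC)
  have 5: "card (children (n + k) ?p 0) \<le> Suc m"
    using children_join_parent(1)[OF r(1) s(1), of 0] pos cB(2)
    by (simp add: card_insert_if)
  have 6: "0 < i \<longrightarrow> card (children (n + k) ?p i) \<le> 5" if "i < n + k" for i
    using that
  proof (rule less_join)
    fix i assume "i < n"
    then show "0 < i \<longrightarrow> card (children (n + k) ?p i) \<le> 5"
      using children_join_parent(1)[OF r(1) s(1), of i] cB(3) by simp
  next
    fix i assume "i < k"
    then show "0 < n + i \<longrightarrow> card (children (n + k) ?p (n + i)) \<le> 5"
      using children_join_parent(2)[OF r(1) s(1), of i] cC(2) by (simp add: card_image)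
  qed
  \<comment> \<open>No edge between \<open>X\<close> and the piece is lost: by symmetry, a vertex of
    \<open>X\<close> adjacent to \<open>u\<close> has a neighbour in \<open>U m\<close>, so it is in
    \<open>?R\<close>.\<close>
  have RN: "N u \<inter> (X \<union> U m) = N u \<inter> (?R \<union> U m)" if "u \<in> U m" for u
    using that sym by blast
  have 7: "\<exists>i<n + k. u \<in> ?B i \<and> w \<in> ?B i"
    if "j < Suc m" "u \<in> U j" "w \<in> N u \<inter> (X \<union> U j)" for j u w
  proof (cases "j = m")
    case True
    then show ?thesis using eC[of u w] that RN[of u] unfolding ex_join_iff by auto
  next
    case False
    then show ?thesis using eB[of j u w] that unfolding ex_join_iff by auto
  qed
  have 8: "card (nodes_of (n + k) ?B u) \<le> card (N u \<inter> (X \<union> U j)) + 1"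
    if "j < Suc m" "u \<in> U j" for j u
  proof (cases "j = m")
    case True
    then have "u \<notin> X \<union> ?W" using dm that by blast
    then show ?thesis using nodes[of u] zB[of u] uC[of u] that True RN[of u] by simp
  next
    case False
    then have "u \<in> ?W" "j < m" using that by auto
    then have "u \<notin> ?R \<union> U m" using dm Suc.prems(2)[of j] that by blast
    then show ?thesis using nodes[of u] zC[of u] uB[of j u] \<open>j < m\<close> that by simp
  qed
  have 9: "card (nodes_of (n + k) ?B v) \<le> 1 + card (N v \<inter> (\<Union>j<Suc m. U j))" if "v \<in> X" for v
  proof -
    have "N v \<inter> (\<Union>j<Suc m. U j) = (N v \<inter> ?W) \<union> (N v \<inter> U m)" unfolding W by blast
    moreover have "(N v \<inter> ?W) \<inter> (N v \<inter> U m) = {}" using dm by blast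
    ultimately have c: "card (N v \<inter> (\<Union>j<Suc m. U j)) = card (N v \<inter> ?W) + card (N v \<inter> U m)"
      using fin[of v] by (simp add: card_Un_disjoint)
    \<comment> \<open>If \<open>v\<close> enters the piece at all, it has a neighbour in
      \<open>U m\<close>, and then \<open>max 1\<close> has no effect. So the summands add up to the
      number of neighbours in all pieces, and the 1 counts the root.\<close>
    have "card (nodes_of k C v) \<le> card (N v \<inter> U m)"
    proof (cases "v \<in> ?R")
      case True
      then have "0 < card (N v \<inter> U m)" using fin[of v] by (auto simp: card_gt_0_iff)
      then show ?thesis using xC[OF True] by linarith
    next
      case False
      then show ?thesis using zC[of v] dm that by auto
    qed
    then show ?thesis using nodes[of v] xB[OF that] c by linarith
  qed
  show ?case
    by (rule exI[of _ "n + k"], rule exI[of _ ?p], rule exI[of _ ?B], intro conjI allI impI ballI;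
        rule 1 2 3 4 5 6[rule_format] 7 8 9; assumption)
qed

subsection \<open>The recursion\<close>

text \<open>Induction on the size of \<open>U\<close>. The decomposition \<open>B\<close> stays
  fixed and supplies the separators on every level.\<close>

lemma exists_good_decomposition:
  fixes N :: "'a \<Rightarrow> 'a set"
  assumes r: "rooted_decomposition n p B" and B: "\<And>i. i < n \<Longrightarrow> card (B i) \<le> K" and "0 < K"
    and fin: "finite (\<Union>i<n. B i)" "\<And>v. finite (N v)"
    and sym: "\<And>u v. u \<in> N v \<Longrightarrow> v \<in> N u"
    and edge: "\<And>u v. u \<in> N v \<Longrightarrow> \<exists>i<n. u \<in> B i \<and> v \<in> B i"
    and "R \<union> U \<subseteq> (\<Union>i<n. B i)" "R \<inter> U = {}" "card R \<le> 6 * K"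
  shows "good_decomposition N (14 * K) R U"
  using assms(8-)
proof (induction "card U" arbitrary: R U rule: less_induct)
  case less
  have finRU: "finite R" "finite U" using less.prems(1) fin(1) finite_subset by blast+
  show ?case
  proof (cases "U = {}")
    case True
    have "rooted_decomposition 1 (\<lambda>i. i) (\<lambda>_. R)" by (auto simp: rooted_decomposition_def)
    moreover have "children 1 (\<lambda>i. i) 0 = {}" by (auto simp: children_def)
    moreover have "card (nodes_of 1 (\<lambda>_. R) v) \<le> 1" for v
      using card_mono[of "{0}" "nodes_of 1 (\<lambda>_. R) v"] by (auto simp: nodes_of_def)
    ultimately show ?thesis
      unfolding good_decomposition_def
      using True less.prems(3)
      by (intro exI[of _ "1 :: nat"] exI[of _ "\<lambda>i. i"] exI[of _ "\<lambda>_. R"]) auto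
  next
    case False
    then obtain u\<^sub>0 where u0: "u\<^sub>0 \<in> U" by blast
    \<comment> \<open>A neighbour in \<open>U\<close> if there is one; the default keeps the image
      inside \<open>U\<close>.\<close>
    define f where "f v = (if N v \<inter> U = {} then u\<^sub>0 else SOME w. w \<in> N v \<inter> U)" for v
    have f: "f v \<in> U" "N v \<inter> U \<noteq> {} \<Longrightarrow> f v \<in> N v" for v
      using u0 some_in_eq[of "N v \<inter> U"] by (auto simp: f_def)
    \<comment> \<open>\<open>Z\<close> has to be non-empty even if \<open>R\<close> is empty: moving
      it from \<open>U\<close> into the root bag is what makes \<open>U\<close> shrink.\<close>
    define Z where "Z = (if R = {} then {u\<^sub>0} else f ` R)"
    have Z: "Z \<subseteq> U" "Z \<noteq> {}" "finite Z" using u0 f finRU by (auto simp: Z_def)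
    have "card Z \<le> 6 * K"
      using less.prems(3) card_image_le[OF finRU(1), of f] \<open>0 < K\<close> by (auto simp: Z_def)
    define Y where "Y = R \<union> Z"
    have "card Y \<le> 3 * (4 * K)"
      unfolding Y_def using card_Un_le[of R Z] \<open>card Z \<le> 6 * K\<close> less.prems(3) by linarith
    moreover have Y: "finite Y" "Y \<subseteq> R \<union> U" "Y \<subseteq> (\<Union>i<n. B i)"
      using finRU Z less.prems(1) by (auto simp: Y_def)
    ultimately obtain S and c :: "'a \<Rightarrow> nat" where finS: "finite S" and S: "card S \<le> 2 * K" and c: "\<And>v. c v < 5"
      and cB: "\<And>i u v. i < n \<Longrightarrow> u \<in> B i - S \<Longrightarrow> v \<in> B i - S \<Longrightarrow> c u = c v"
      and cY: "\<And>a. card {y \<in> Y - S. c y = a} \<le> 4 * K"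
      using balanced_separator[OF r B fin(1) Y(1) _ Y(3)] by blast
    have cN: "c u = c v" if "u \<in> N v" "u \<notin> S" "v \<notin> S" for u v
      using edge[OF that(1)] cB that by blast
    \<comment> \<open>The separator may contain vertices outside the part being decomposed; these
      are dropped.\<close>
    define X where "X = Y \<union> (S \<inter> (R \<union> U))"
    define W where "W j = {u \<in> U - X. c u = j}" for j
    have W: "(\<Union>j<5. W j) = U - X" using c by (auto simp: W_def)
    have WS: "u \<notin> S" if "u \<in> W j" for u j using that by (auto simp: W_def X_def)
    have "finite X" using Y(1) finRU by (auto simp: X_def)
    have RX: "R \<subseteq> X" "Z \<subseteq> X" "X \<subseteq> R \<union> U" using Y(2) by (auto simp: X_def Y_def)
    have "card X \<le> card Y + card S"
      unfolding X_def using card_Un_le[of Y "S \<inter> (R \<union> U)"] card_mono[OF finS, of "S \<inter> (R \<union> U)"]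
      by auto
    then have cardX: "card X \<le> 14 * K" using S \<open>card Y \<le> 3 * (4 * K)\<close> by linarith
    have good: "good_decomposition N (14 * K) {v \<in> X. N v \<inter> W j \<noteq> {}} (W j)" for j
    proof (rule less.hyps)
      have "W j \<subset> U" using Z RX(2) by (auto simp: W_def)
      then show "card (W j) < card U" using finRU by (intro psubset_card_mono)
      show "{v \<in> X. N v \<inter> W j \<noteq> {}} \<union> W j \<subseteq> (\<Union>i<n. B i)"
        using RX(3) less.prems(1) by (auto simp: W_def)
      show "{v \<in> X. N v \<inter> W j \<noteq> {}} \<inter> W j = {}" by (auto simp: W_def)
      \<comment> \<open>A vertex outside \<open>S\<close> has the colour of its neighbours in
        \<open>W j\<close>. So a piece inherits at most \<open>2 * K\<close> vertices of
        \<open>S\<close> and \<open>4 * K\<close> vertices of \<open>Y\<close>, which restores the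
        bound \<open>6 * K\<close>.\<close>
      have "{v \<in> X. N v \<inter> W j \<noteq> {}} \<subseteq> S \<union> {y \<in> Y - S. c y = j}"
      proof
        fix v assume "v \<in> {v \<in> X. N v \<inter> W j \<noteq> {}}"
        then obtain u where u: "v \<in> X" "u \<in> N v" "u \<in> W j" by blast
        then have "c u = j" "u \<notin> S" using WS by (auto simp: W_def)
        then show "v \<in> S \<union> {y \<in> Y - S. c y = j}"
          using u cN[OF u(2)] by (auto simp: X_def)
      qed
      then have "card {v \<in> X. N v \<inter> W j \<noteq> {}} \<le> card (S \<union> {y \<in> Y - S. c y = j})"
        using finS Y(1) by (intro card_mono) auto
      also have "\<dots> \<le> card S + card {y \<in> Y - S. c y = j}" by (rule card_Un_le)
      also have "\<dots> \<le> 6 * K" using S cY[of j] by linarith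
      finally show "card {v \<in> X. N v \<inter> W j \<noteq> {}} \<le> 6 * K" .
    qed
    have "\<exists>n p B. rooted_decomposition n p B \<and> (\<Union>i<n. B i) = X \<union> (\<Union>j<5. W j) \<and> B 0 = X \<and>
      (\<forall>i<n. card (B i) \<le> 14 * K) \<and> card (children n p 0) \<le> 5 \<and>
      (\<forall>i<n. 0 < i \<longrightarrow> card (children n p i) \<le> 5) \<and>
      (\<forall>j<5. \<forall>u\<in>W j. \<forall>w\<in>N u \<inter> (X \<union> W j). \<exists>i<n. u \<in> B i \<and> w \<in> B i) \<and>
      (\<forall>j<5. \<forall>u\<in>W j. card (nodes_of n B u) \<le> card (N u \<inter> (X \<union> W j)) + 1) \<and>
      (\<forall>v\<in>X. card (nodes_of n B v) \<le> 1 + card (N v \<inter> (\<Union>j<5. W j)))"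
      by (rule glue_decompositions[OF cardX fin(2) _ _ good sym order_refl]) (auto simp: W_def)
    then obtain n' p' B' where r': "rooted_decomposition n' p' B'"
      and UB: "(\<Union>i<n'. B' i) = X \<union> (U - X)" and B0: "B' 0 = X"
      and b: "\<forall>i<n'. card (B' i) \<le> 14 * K" and c0: "card (children n' p' 0) \<le> 5"
      and ci: "\<forall>i<n'. 0 < i \<longrightarrow> card (children n' p' i) \<le> 5"
      and e: "\<forall>j<5. \<forall>u\<in>W j. \<forall>w\<in>N u \<inter> (X \<union> W j). \<exists>i<n'. u \<in> B' i \<and> w \<in> B' i"
      and s: "\<forall>j<5. \<forall>u\<in>W j. card (nodes_of n' B' u) \<le> card (N u \<inter> (X \<union> W j)) + 1"
      and sX: "\<forall>v\<in>X. card (nodes_of n' B' v) \<le> 1 + card (N v \<inter> (U - X))"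
      unfolding W by (elim exE conjE) (rule that)
    have "0 < n'" using r' by (simp add: rooted_decomposition_def)
    have Wi: "\<exists>j<5. u \<in> W j" if "u \<in> U - X" for u using that W by blast
    have 1: "(\<Union>i<n'. B' i) = R \<union> U" unfolding UB using RX by blast
    have 2: "card (B' i) \<le> 14 * K \<and> card (children n' p' i) \<le> 5" if "i < n'" for i
      using that b c0 ci by (cases "i = 0") auto
    have 3: "\<exists>i<n'. u \<in> B' i \<and> w \<in> B' i" if u: "u \<in> U" and w: "w \<in> N u \<inter> (R \<union> U)" for u w
    proof -
      have w': "w \<in> N u" "u \<in> N w" "w \<in> R \<union> U" using w sym by auto
      consider "u \<in> X" "w \<in> X" | "u \<in> U - X" | "u \<in> X" "w \<in> U - X" using u w RX(1) by blast
      then show ?thesis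
      proof cases
        case 1
        then show ?thesis using \<open>0 < n'\<close> B0 by blast
      next
        case 2
        then obtain j where j: "j < 5" "u \<in> W j" using Wi by blast
        \<comment> \<open>No edge joins different classes: outside \<open>X\<close>, a neighbour of
          \<open>u\<close> has the colour of \<open>u\<close>.\<close>
        have "w \<in> X \<union> W j"
        proof (cases "w \<in> X")
          case False
          then have "w \<in> U - X" using w' RX(1) by blast
          moreover have "w \<notin> S" "u \<notin> S" using False w' WS j by (auto simp: X_def)
          then have "c w = c u" using cN w' by blast
          ultimately show ?thesis using j by (auto simp: W_def)
        qed simp
        then show ?thesis using e j w' by blast
      next
        case 3
        then obtain j where "j < 5" "w \<in> W j" using Wi by blast
        then have "\<exists>i<n'. w \<in> B' i \<and> u \<in> B' i" using e w' 3 by blast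
        then show ?thesis by blast
      qed
    qed
    have 4: "card (nodes_of n' B' u) \<le> card (N u \<inter> (R \<union> U)) + 1" if u: "u \<in> U" for u
    proof (cases "u \<in> X")
      case True
      \<comment> \<open>A vertex of \<open>U\<close> that enters the root bag already here: the
        \<open>+ 1\<close> of its bound pays for the root node.\<close>
      have "card (N u \<inter> (U - X)) \<le> card (N u \<inter> (R \<union> U))" using fin(2) by (intro card_mono) auto
      then show ?thesis using sX[rule_format, OF True] by linarith
    next
      case False
      then obtain j where j: "j < 5" "u \<in> W j" using Wi u by blast
      have "card (N u \<inter> (X \<union> W j)) \<le> card (N u \<inter> (R \<union> U))"
        using fin(2) RX(3) by (intro card_mono) (auto simp: W_def)
      then show ?thesis using s[rule_format, OF j] by linarith
    qed
    have 5: "card (nodes_of n' B' v) \<le> max 1 (card (N v \<inter> U))" if v: "v \<in> R" for v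
    proof (cases "N v \<inter> U = {}")
      case True
      then have "N v \<inter> (U - X) = {}" by blast
      then show ?thesis using sX RX(1) v by fastforce
    next
      case False
      \<comment> \<open>The neighbour \<open>f v\<close> already lies in the root bag; this pays for the root node.\<close>
      have "f v \<in> Z" using v by (auto simp: Z_def)
      then have "N v \<inter> (U - X) \<subset> N v \<inter> U" using f[of v] False RX(2) by blast
      then have "card (N v \<inter> (U - X)) < card (N v \<inter> U)" using fin(2) by (intro psubset_card_mono) auto
      then show ?thesis using sX[rule_format, of v] RX(1) v by fastforce
    qed
    show ?thesis
      unfolding good_decomposition_def
      by (rule exI[of _ n'], rule exI[of _ p'], rule exI[of _ B'])
        (use r' 1 2 3 4 5 RX(1) B0 in blast)
  qed
qed

section \<open>From treewidth to rooted decompositions and back\<close>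

lemma exists_minimum_int:
  fixes P :: "int \<Rightarrow> bool"
  assumes "P w" "\<And>w. P w \<Longrightarrow> b \<le> w"
  shows "P (LEAST w. P w)"
proof -
  \<comment> \<open>The integers are not well-ordered, but measured from the lower bound
    \<open>b\<close> the values are natural numbers.\<close>
  define m where "m = (LEAST m. P (b + int m))"
  have ex: "P (b + int (nat (w - b)))" using assms by auto
  then have "P (b + int m)" unfolding m_def by (rule LeastI)
  moreover have "b + int m \<le> v" if "P v" for v
  proof -
    have "m \<le> nat (v - b)"
      unfolding m_def using that assms(2)[OF that] by (intro Least_le) auto
    then show ?thesis using assms(2)[OF that] by linarith
  qed
  ultimately show ?thesis using Least_equality[of P "b + int m"] by auto
qed

lemma treewidth_attained:
  assumes "pair_graph G"
  obtains T :: "nat pair_pre_digraph" and B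
    where "tree_decomposition T B G" "decomposition_width T B = treewidth G"
proof -
  interpret pair_graph G by fact
  let ?P = "\<lambda>w. \<exists>(T :: nat pair_pre_digraph) B. tree_decomposition T B G \<and> decomposition_width T B = w"
  have "tree_decomposition (parent_graph 1 (\<lambda>i. i)) (\<lambda>_. pverts G) G"
    by (rule tree_decomposition_parent_graph)
      (auto simp: rooted_decomposition_def lessThan_Suc dest: in_arcsD1 in_arcsD2)
  then have "?P (decomposition_width (parent_graph 1 (\<lambda>i. i)) (\<lambda>_. pverts G))" by blast
  moreover have "-1 \<le> w" if "?P w" for w using that by (auto simp: decomposition_width_def)
  ultimately have "?P (treewidth G)" unfolding treewidth_def by (rule exists_minimum_int)
  then show ?thesis using that by blast
qed

text \<open>Only the set of bags is related to the old decomposition; bag sizes and covered edges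
  depend on nothing else.\<close>

lemma rooted_decomposition_of_tree_decomposition:
  assumes "tree_decomposition T B G"
  obtains n p C where "rooted_decomposition n p C" "C ` {..<n} = B ` pverts T"
proof -
  have tree: "undirected_tree T" and sub: "\<And>x. x \<in> pverts T \<Longrightarrow> B x \<subseteq> pverts G"
    and conn: "\<And>v. v \<in> pverts G \<Longrightarrow> connected (with_proj T \<restriction> bag_nodes T B v)"
    using assms by (auto simp: tree_decomposition_def)
  interpret pair_graph T using tree by (simp add: undirected_tree_def)
  have sym: "sym (parcs T)" using pair_sym_arcs by (simp add: symmetric_def)
  have wf: "pair_wf_digraph T" by unfold_locales
  have "irrefl (parcs T)" using pair_no_loops by (force simp: irrefl_def)
  moreover have "acyclic_on (parcs T) (pverts T)"
    using tree unfolding acyclic_on_iff[OF wf] undirected_tree_def by blast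
  moreover have "connected_on (parcs T) (pverts T)"
    using tree connected_induce_iff[OF sym, of "pverts T"]
    by (simp add: undirected_tree_def induce_subgraph_pverts[OF wf])
  moreover have "{x \<in> pverts T. v \<in> B x} = {} \<or> connected_on (parcs T) {x \<in> pverts T. v \<in> B x}" for v
  proof (cases "v \<in> pverts G")
    case True
    then show ?thesis
      using conn[of v] connected_induce_iff[OF sym] by (simp add: bag_nodes_def)
  next
    case False
    then show ?thesis using sub by blast
  qed
  ultimately obtain \<sigma> p where \<sigma>: "bij_betw \<sigma> {..<card (pverts T)} (pverts T)"
      "rooted_decomposition (card (pverts T)) p (B \<circ> \<sigma>)"
    using rooted_decomposition_of_tree[OF pair_finite_verts sym] by blast
  have "(B \<circ> \<sigma>) ` {..<card (pverts T)} = B ` pverts T"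
    using \<sigma>(1) by (metis bij_betw_def image_comp)
  then show ?thesis using that[OF \<sigma>(2)] by simp
qed

lemma out_degree_parent_graph:
  assumes "rooted_decomposition n p B" "i < n" "card (children n p i) \<le> d"
  shows "out_degree (with_proj (parent_graph n p)) i \<le> d + 1"
proof -
  \<comment> \<open>At the root, \<open>p 0\<close> is an arbitrary value, which is harmless in an
    upper bound.\<close>
  have "out_arcs (with_proj (parent_graph n p)) i \<subseteq> Pair i ` insert (p i) (children n p i)"
    by (auto simp: out_arcs_def children_def)
  then have "out_degree (with_proj (parent_graph n p)) i \<le> card (Pair i ` insert (p i) (children n p i))"
    unfolding out_degree_def by (intro card_mono) auto
  also have "\<dots> \<le> card (insert (p i) (children n p i))" by (intro card_image_le) auto
  also have "\<dots> \<le> card (children n p i) + 1" by (simp add: card_insert_if)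
  finally show ?thesis using assms(3) by linarith
qed

lemma Max_image_le:
  assumes "finite A" "A \<noteq> {}" "\<And>x. x \<in> A \<Longrightarrow> f x \<le> b"
  shows "Max (f ` A) \<le> b"
  using assms by simp

theorem theorem5:
  fixes G :: "'a pair_pre_digraph" and k :: nat
  assumes "pair_graph G"
    and "treewidth G = int k"
  shows "\<exists>(T :: nat pair_pre_digraph) B.
    tree_decomposition T B G \<and>
    decomposition_width T B \<le> 14 * int k + 13 \<and>
    max_degree T \<le> 6 \<and>
    (\<forall>v \<in> pverts G. spread T B v \<le> out_degree (with_proj G) v + 1)"
proof -
  interpret pair_graph G by fact
  obtain T :: "nat pair_pre_digraph" and B where TB: "tree_decomposition T B G"
    and w: "decomposition_width T B = int k"
    using treewidth_attained[OF assms(1)] assms(2) by metis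
  obtain n p C where r: "rooted_decomposition n p C" and CB: "C ` {..<n} = B ` pverts T"
    using rooted_decomposition_of_tree_decomposition[OF TB] .
  have "finite (pverts T)"
    using TB by (auto simp: tree_decomposition_def undirected_tree_def pair_graph_def
        pair_digraph_def pair_fin_digraph_def pair_fin_digraph_axioms_def)
  then have "card (B x) \<le> Max ((\<lambda>x. card (B x)) ` pverts T)" if "x \<in> pverts T" for x
    using that by (intro Max_ge) auto
  then have "card (B x) \<le> k + 1" if "x \<in> pverts T" for x
    using w that unfolding decomposition_width_def by fastforce
  then have Ck: "card (C i) \<le> k + 1" if "i < n" for i
    using CB that by (metis (no_types, lifting) imageE imageI lessThan_iff)
  have CG: "(\<Union>i<n. C i) = pverts G"
  proof -
    have "(\<Union>x\<in>pverts T. B x) = pverts G"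
      using TB by (fastforce simp: tree_decomposition_def bag_nodes_def)
    then show ?thesis using CB by simp
  qed
  define N where "N v = {w. (v, w) \<in> parcs G}" for v
  have out: "out_degree (with_proj G) v = card (N v)" for v
  proof -
    have "out_arcs (with_proj G) v = Pair v ` N v" by (auto simp: out_arcs_def N_def)
    then show ?thesis by (simp add: out_degree_def card_image inj_on_def)
  qed
  have NG: "N v \<subseteq> pverts G" for v by (auto simp: N_def dest: in_arcsD2)
  then have finN: "finite (N v)" for v using pair_finite_verts finite_subset by blast
  have symN: "v \<in> N u" if "u \<in> N v" for u v
    using that pair_sym_arcs by (auto simp: N_def symmetric_def dest: symD)
  have edgeN: "\<exists>i<n. u \<in> C i \<and> v \<in> C i" if uv: "u \<in> N v" for u v
  proof -
    have "\<forall>(v, w) \<in> parcs G. \<exists>x \<in> pverts T. v \<in> B x \<and> w \<in> B x"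
      using TB unfolding tree_decomposition_def by (elim conjE)
    then obtain x where x: "x \<in> pverts T" "v \<in> B x" "u \<in> B x"
      using uv unfolding N_def by blast
    then have "B x \<in> C ` {..<n}" unfolding CB by blast
    then show ?thesis using x by auto
  qed
  \<comment> \<open>At the top nothing is prescribed, so every vertex falls under the bound for
    \<open>U\<close>. Bags of a decomposition of width \<open>k\<close> have at most
    \<open>k + 1\<close> elements, hence this choice of \<open>K\<close>.\<close>
  have "good_decomposition N (14 * (k + 1)) {} (pverts G)"
    by (rule exists_good_decomposition[OF r Ck]) (use CG finN symN edgeN pair_finite_verts in auto)
  then obtain m q D where D: "rooted_decomposition m q D" "(\<Union>i<m. D i) = pverts G"
    and b: "\<forall>i<m. card (D i) \<le> 14 * (k + 1) \<and> card (children m q i) \<le> 5"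
    and e: "\<forall>u\<in>pverts G. \<forall>w\<in>N u \<inter> pverts G. \<exists>i<m. u \<in> D i \<and> w \<in> D i"
    and s: "\<forall>u\<in>pverts G. card (nodes_of m D u) \<le> card (N u \<inter> pverts G) + 1"
    unfolding good_decomposition_def Un_empty_left by (elim exE conjE) (rule that)
  have "0 < m" using D(1) by (simp add: rooted_decomposition_def)
  let ?T = "parent_graph m q"
  have "tree_decomposition ?T D G"
    using D
  proof (rule tree_decomposition_parent_graph)
    fix v w assume "(v, w) \<in> parcs G"
    then have "v \<in> pverts G" "w \<in> N v \<inter> pverts G" by (auto simp: N_def dest: in_arcsD1 in_arcsD2)
    then show "\<exists>i<m. v \<in> D i \<and> w \<in> D i" using e by blast
  qed
  moreover have width: "int a - 1 \<le> 14 * int k + 13" if "a \<le> 14 * (k + 1)" for a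
    using that by presburger
  have "Max ((\<lambda>x. card (D x)) ` pverts ?T) \<le> 14 * (k + 1)"
    using b \<open>0 < m\<close> by (intro Max_image_le) auto
  then have "decomposition_width ?T D \<le> 14 * int k + 13"
    unfolding decomposition_width_def by (rule width)
  moreover have "max_degree ?T \<le> 6"
    unfolding max_degree_def
  proof (rule Max_image_le)
    show "out_degree (with_proj ?T) i \<le> 6" if "i \<in> pverts ?T" for i
      using out_degree_parent_graph[OF D(1), of i 5] b that by simp
  qed (use \<open>0 < m\<close> in auto)
  moreover have "spread ?T D v \<le> out_degree (with_proj G) v + 1" if "v \<in> pverts G" for v
  proof -
    have "bag_nodes ?T D v = nodes_of m D v" by (auto simp: bag_nodes_def nodes_of_def)
    moreover have "N v \<inter> pverts G = N v" using NG by blast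
    ultimately show ?thesis using s[rule_format, OF that] by (simp add: spread_def out)
  qed
  ultimately show ?thesis by blast
qed

end
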